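(* Let $\tau\in(0,(1+\sqrt5)/2)$. Suppose that $\overline\Omega\ne\emptyset$ and that both $\Sigma_{\vartheta_g}+\mathcal S+\sigma\mathcal A\mathcal A^*$ and $\Sigma_{\varphi_h}+\mathcal T+\sigma\mathcal B\mathcal B^*$ are positive definite. Assume that the mapping $R:\mathcal U\to\mathcal U$ is piecewise polyhedral. Then there exists a constant $\varsigma\in(0,1)$ such that the infinite sequence $\{u^k=(y^k,z^k,x^k)\}$ generated by the sPADMM satisfies $$\mathrm{dist}^2_{\mathcal M}(u^{k+1},\overline\Omega)+\|z^{k+1}-z^k\|^2_{\mathcal T}\le \varsigma\left[\mathrm{dist}^2_{\mathcal M}(u^{k},\overline\Omega)+\|z^{k}-z^{k-1}\|^2_{\mathcal T}\right],\quad\forall\,k\ge1.$$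
   Context: $\mathcal X,\mathcal Y,\mathcal Z$ are finite-dimensional real Euclidean spaces, $\mathcal U:=\mathcal Y\times\mathcal Z\times\mathcal X$. $\vartheta:\mathcal Y\to(-\infty,+\infty]$, $\varphi:\mathcal Z\to(-\infty,+\infty]$ are proper closed convex functions, $g:\mathcal Y\to\mathbb R$, $h:\mathcal Z\to\mathbb R$ are continuously differentiable convex functions, $\mathcal A:\mathcal X\to\mathcal Y$, $\mathcal B:\mathcal X\to\mathcal Z$ are linear with adjoints $\mathcal A^*,\mathcal B^*$, and $c\in\mathcal X$. Put $\vartheta_g=\vartheta+g$, $\varphi_h=\varphi+h$. The problem is $$\min\{\vartheta(y)+g(y)+\varphi(z)+h(z):\ \mathcal A^*y+\mathcal B^*z=c,\ y\in\mathcal Y,\ z\in\mathcal Z\}.$$ $\overline\Omega$ is the set of $(y,z,x)\in\mathcal U$ with $0\in\partial\vartheta(y)+\nabla g(y)+\mathcal Ax$, $0\in\partial\varphi(z)+\nabla h(z)+\mathcal Bx$, $c-\mathcal A^*y-\mathcal B^*z=0$. With $\mathrm{Pr}_\theta$ the Moreau–Yosida proximal mapping of $\theta$ ($\mathrm{Pr}_\theta(v)=\arg\min_w\{\theta(w)+\frac12\|w-v\|^2\}$), the KKT mapping $R:\mathcal U\to\mathcal U$ is $$R(u)=\big(y-\mathrm{Pr}_\vartheta[y-(\nabla g(y)+\mathcal Ax)],\ z-\mathrm{Pr}_\varphi[z-(\nabla h(z)+\mathcal Bx)],\ c-\mathcal A^*y-\mathcal B^*z\big),\quad u=(y,z,x).$$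 A (multi-valued) mapping is piecewise polyhedral if its graph is the union of finitely many polyhedral sets. sPADMM: let $\sigma>0$, $\tau>0$, and let $\mathcal S:\mathcal Y\to\mathcal Y$, $\mathcal T:\mathcal Z\to\mathcal Z$ be self-adjoint positive semi-definite linear operators. With $\mathcal L_\sigma(y,z;x)=\vartheta_g(y)+\varphi_h(z)+\langle x,\mathcal A^*y+\mathcal B^*z-c\rangle+\frac\sigma2\|\mathcal A^*y+\mathcal B^*z-c\|^2$ and $(y^0,z^0,x^0)\in\mathrm{dom}\,\vartheta\times\mathrm{dom}\,\varphi\times\mathcal X$, for $k=0,1,\dots$: $y^{k+1}\in\arg\min_y\mathcal L_\sigma(y,z^k;x^k)+\frac12\|y-y^k\|_{\mathcal S}^2$; $z^{k+1}\in\arg\min_z\mathcal L_\sigma(y^{k+1},z;x^k)+\frac12\|z-z^k\|_{\mathcal T}^2$; $x^{k+1}=x^k+\tau\sigma(\mathcal A^*y^{k+1}+\mathcal B^*z^{k+1}-c)$. For a self-adjoint positive semi-definite $\mathcal N$: $\|v\|_{\mathcal N}=\sqrt{\langle v,\mathcal Nv\rangle}$, $\mathrm{dist}_{\mathcal N}(v,C)=\inf_{v'\in C}\|v'-v\|_{\mathcal N}$; $\mathcal I$ is the identity. $\Sigma_{\vartheta_g},\Sigma_{\varphi_h}$ are fixed self-adjoint positive semi-definite operators with $\langle\xi'-\xi,y'-y\rangle\ge\|y'-y\|^2_{\Sigma_{\vartheta_g}}$ for all $\xi\in\partial\vartheta_g(y)$, $\xi'\in\partial\vartheta_g(y')$,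 and $\langle\zeta'-\zeta,z'-z\rangle\ge\|z'-z\|^2_{\Sigma_{\varphi_h}}$ for all $\zeta\in\partial\varphi_h(z)$, $\zeta'\in\partial\varphi_h(z')$. $\mathcal E:\mathcal X\to\mathcal U$ is the linear operator with adjoint $\mathcal E^*(y,z,x)=\mathcal A^*y+\mathcal B^*z$. $s_\tau:=\frac{5-\tau-3\min\{\tau,\tau^{-1}\}}4$ and $$\mathcal M:=\mathrm{Diag}\big(\mathcal S+\Sigma_{\vartheta_g},\ \mathcal T+\Sigma_{\varphi_h}+\sigma\mathcal B\mathcal B^*,\ (\tau\sigma)^{-1}\mathcal I\big)+s_\tau\sigma\,\mathcal E\mathcal E^*.$$ *)

theory Defs
  imports "HOL-Analysis.Analysis"
begin

subsection \<open>Convex analysis\<close>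

definition proper_closed_convex :: "('a::euclidean_space \<Rightarrow> ereal) \<Rightarrow> bool" where
  "proper_closed_convex f \<longleftrightarrow>
     (\<forall>v. f v \<noteq> -\<infinity>) \<and> (\<exists>v. f v \<noteq> \<infinity>) \<and>
     closed {(v, r::real). f v \<le> ereal r} \<and>
     convex {(v, r::real). f v \<le> ereal r}"

definition eff_dom :: "('a \<Rightarrow> ereal) \<Rightarrow> 'a set" where
  "eff_dom f = {v. f v < \<infinity>}"

definition subdiff :: "('a::euclidean_space \<Rightarrow> ereal) \<Rightarrow> 'a \<Rightarrow> 'a set" where
  "subdiff f v = {\<xi>. \<forall>w. f v + ereal (\<xi> \<bullet> (w - v)) \<le> f w}"

definition argmins :: "('a \<Rightarrow> ereal) \<Rightarrow> 'a set" where
  "argmins f = {v. is_arg_min f (\<lambda>_. True) v}"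

text \<open>For a proper closed convex function the minimizer below exists and is unique.\<close>

definition prox :: "('a::euclidean_space \<Rightarrow> ereal) \<Rightarrow> 'a \<Rightarrow> 'a" where
  "prox f v = arg_min (\<lambda>w. f w + ereal (1/2 * (norm (w - v))\<^sup>2)) (\<lambda>_. True)"

definition grad :: "('a::euclidean_space \<Rightarrow> real) \<Rightarrow> 'a \<Rightarrow> 'a" where
  "grad f v = (THE d. GDERIV f v :> d)"

definition cont_diff_convex :: "('a::euclidean_space \<Rightarrow> real) \<Rightarrow> bool" where
  "cont_diff_convex f \<longleftrightarrow>
     f differentiable_on UNIV \<and> continuous_on UNIV (grad f) \<and> convex_on UNIV f"

definition piecewise_polyhedral ::
    "('a::euclidean_space \<Rightarrow> 'b::euclidean_space set) \<Rightarrow> bool" where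
  "piecewise_polyhedral F \<longleftrightarrow>
     (\<exists>P. finite P \<and> (\<forall>Q\<in>P. polyhedron Q) \<and> {(u, v). v \<in> F u} = \<Union>P)"

subsection \<open>Self-adjoint operators and seminorms\<close>

definition self_adjoint :: "('a::euclidean_space \<Rightarrow> 'a) \<Rightarrow> bool" where
  "self_adjoint N \<longleftrightarrow> linear N \<and> adjoint N = N"

definition pos_semidef :: "('a::euclidean_space \<Rightarrow> 'a) \<Rightarrow> bool" where
  "pos_semidef N \<longleftrightarrow> self_adjoint N \<and> (\<forall>v. 0 \<le> v \<bullet> N v)"

definition pos_def :: "('a::euclidean_space \<Rightarrow> 'a) \<Rightarrow> bool" where
  "pos_def N \<longleftrightarrow> self_adjoint N \<and> (\<forall>v. v \<noteq> 0 \<longrightarrow> 0 < v \<bullet> N v)"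

definition op_norm :: "('a::euclidean_space \<Rightarrow> 'a) \<Rightarrow> 'a \<Rightarrow> real" where
  "op_norm N v = sqrt (v \<bullet> N v)"

definition op_dist :: "('a::euclidean_space \<Rightarrow> 'a) \<Rightarrow> 'a \<Rightarrow> 'a set \<Rightarrow> real" where
  "op_dist N v C = (INF v'\<in>C. op_norm N (v' - v))"

definition monotone_modulus ::
    "('a::euclidean_space \<Rightarrow> ereal) \<Rightarrow> ('a \<Rightarrow> 'a) \<Rightarrow> bool" where
  "monotone_modulus f \<Sigma> \<longleftrightarrow> pos_semidef \<Sigma> \<and>
     (\<forall>v v'. \<forall>\<xi>\<in>subdiff f v. \<forall>\<xi>'\<in>subdiff f v'.
        (\<xi>' - \<xi>) \<bullet> (v' - v) \<ge> (op_norm \<Sigma> (v' - v))\<^sup>2)"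

subsection \<open>The composite problem and its KKT system\<close>

definition plus_smooth :: "('a \<Rightarrow> ereal) \<Rightarrow> ('a \<Rightarrow> real) \<Rightarrow> 'a \<Rightarrow> ereal" where
  "plus_smooth f g v = f v + ereal (g v)"

definition KKT_set ::
    "('y::euclidean_space \<Rightarrow> ereal) \<Rightarrow> ('y \<Rightarrow> real) \<Rightarrow> ('z::euclidean_space \<Rightarrow> ereal) \<Rightarrow> ('z \<Rightarrow> real)
     \<Rightarrow> ('x::euclidean_space \<Rightarrow> 'y) \<Rightarrow> ('x \<Rightarrow> 'z) \<Rightarrow> 'x \<Rightarrow> ('y \<times> 'z \<times> 'x) set" where
  "KKT_set \<theta> g \<phi> h A B c =
     {(y, z, x).
        0 \<in> (\<lambda>\<xi>. \<xi> + grad g y + A x) ` subdiff \<theta> y \<and>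
        0 \<in> (\<lambda>\<zeta>. \<zeta> + grad h z + B x) ` subdiff \<phi> z \<and>
        c - adjoint A y - adjoint B z = 0}"

definition KKT_map ::
    "('y::euclidean_space \<Rightarrow> ereal) \<Rightarrow> ('y \<Rightarrow> real) \<Rightarrow> ('z::euclidean_space \<Rightarrow> ereal) \<Rightarrow> ('z \<Rightarrow> real)
     \<Rightarrow> ('x::euclidean_space \<Rightarrow> 'y) \<Rightarrow> ('x \<Rightarrow> 'z) \<Rightarrow> 'x \<Rightarrow> ('y \<times> 'z \<times> 'x) \<Rightarrow> ('y \<times> 'z \<times> 'x)" where
  "KKT_map \<theta> g \<phi> h A B c = (\<lambda>(y, z, x).
     (y - prox \<theta> (y - (grad g y + A x)),
      z - prox \<phi> (z - (grad h z + B x)),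
      c - adjoint A y - adjoint B z))"

subsection \<open>The semi-proximal ADMM\<close>

definition aug_lagrangian ::
    "('y::euclidean_space \<Rightarrow> ereal) \<Rightarrow> ('y \<Rightarrow> real) \<Rightarrow> ('z::euclidean_space \<Rightarrow> ereal) \<Rightarrow> ('z \<Rightarrow> real)
     \<Rightarrow> ('x::euclidean_space \<Rightarrow> 'y) \<Rightarrow> ('x \<Rightarrow> 'z) \<Rightarrow> 'x \<Rightarrow> real \<Rightarrow> 'y \<Rightarrow> 'z \<Rightarrow> 'x \<Rightarrow> ereal" where
  "aug_lagrangian \<theta> g \<phi> h A B c \<sigma> y z x =
     plus_smooth \<theta> g y + plus_smooth \<phi> h z
     + ereal (x \<bullet> (adjoint A y + adjoint B z - c))
     + ereal (\<sigma> / 2 * (norm (adjoint A y + adjoint B z - c))\<^sup>2)"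

definition sPADMM_sequence ::
    "('y::euclidean_space \<Rightarrow> ereal) \<Rightarrow> ('y \<Rightarrow> real) \<Rightarrow> ('z::euclidean_space \<Rightarrow> ereal) \<Rightarrow> ('z \<Rightarrow> real)
     \<Rightarrow> ('x::euclidean_space \<Rightarrow> 'y) \<Rightarrow> ('x \<Rightarrow> 'z) \<Rightarrow> 'x \<Rightarrow> real \<Rightarrow> real
     \<Rightarrow> ('y \<Rightarrow> 'y) \<Rightarrow> ('z \<Rightarrow> 'z) \<Rightarrow> (nat \<Rightarrow> 'y) \<Rightarrow> (nat \<Rightarrow> 'z) \<Rightarrow> (nat \<Rightarrow> 'x) \<Rightarrow> bool" where
  "sPADMM_sequence \<theta> g \<phi> h A B c \<sigma> \<tau> S T y z x \<longleftrightarrow>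
     y 0 \<in> eff_dom \<theta> \<and> z 0 \<in> eff_dom \<phi> \<and>
     (\<forall>k.
        y (Suc k) \<in> argmins (\<lambda>v. aug_lagrangian \<theta> g \<phi> h A B c \<sigma> v (z k) (x k)
                                  + ereal (1/2 * (op_norm S (v - y k))\<^sup>2)) \<and>
        z (Suc k) \<in> argmins (\<lambda>w. aug_lagrangian \<theta> g \<phi> h A B c \<sigma> (y (Suc k)) w (x k)
                                  + ereal (1/2 * (op_norm T (w - z k))\<^sup>2)) \<and>
        x (Suc k) = x k + (\<tau> * \<sigma>) *\<^sub>R (adjoint A (y (Suc k)) + adjoint B (z (Suc k)) - c))"

subsection \<open>The operator defining the distance\<close>

definition E_adj ::
    "('x::euclidean_space \<Rightarrow> 'y::euclidean_space) \<Rightarrow> ('x \<Rightarrow> 'z::euclidean_space)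
     \<Rightarrow> ('y \<times> 'z \<times> 'x) \<Rightarrow> 'x" where
  "E_adj A B = (\<lambda>(y, z, x). adjoint A y + adjoint B z)"

text \<open>The operator \<open>E\<close> is given through its adjoint; for linear \<open>A\<close>, \<open>B\<close>
  it is the map \<open>x \<mapsto> (A x, B x, 0)\<close>.\<close>

definition E_op ::
    "('x::euclidean_space \<Rightarrow> 'y::euclidean_space) \<Rightarrow> ('x \<Rightarrow> 'z::euclidean_space)
     \<Rightarrow> 'x \<Rightarrow> ('y \<times> 'z \<times> 'x)" where
  "E_op A B = adjoint (E_adj A B)"

definition s_tau :: "real \<Rightarrow> real" where
  "s_tau \<tau> = (5 - \<tau> - 3 * min \<tau> (inverse \<tau>)) / 4"

definition M_op ::
    "('x::euclidean_space \<Rightarrow> 'y::euclidean_space) \<Rightarrow> ('x \<Rightarrow> 'z::euclidean_space) \<Rightarrow> real \<Rightarrow> real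
     \<Rightarrow> ('y \<Rightarrow> 'y) \<Rightarrow> ('z \<Rightarrow> 'z) \<Rightarrow> ('y \<Rightarrow> 'y) \<Rightarrow> ('z \<Rightarrow> 'z)
     \<Rightarrow> ('y \<times> 'z \<times> 'x) \<Rightarrow> ('y \<times> 'z \<times> 'x)" where
  "M_op A B \<sigma> \<tau> S T \<Sigma>\<theta> \<Sigma>\<phi> = (\<lambda>(y, z, x).
     (S y + \<Sigma>\<theta> y,
      T z + \<Sigma>\<phi> z + \<sigma> *\<^sub>R B (adjoint B z),
      inverse (\<tau> * \<sigma>) *\<^sub>R x)
     + (s_tau \<tau> * \<sigma>) *\<^sub>R E_op A B (E_adj A B (y, z, x)))"

end

theory Submission
  imports Defs
begin

text \<open>
  Why the method converges linearly. Write \<open>u\<close> for the triple of iterates, \<open>r = A\<^sup>*y + B\<^sup>*z - c\<close> for the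
  infeasibility and \<open>\<Delta>\<close> for the difference of consecutive iterates. Three estimates, each in terms of the
  length of the last step \<open>\<Delta>u\<close>, are combined.

  \<^item> The step is paid for. For every KKT point \<open>u\<^sup>*\<close>, the energy formed by the squared \<open>M\<close>-distance to \<open>u\<^sup>*\<close>
    and the \<open>T\<close>-length of \<open>\<Delta>z\<close> drops in one iteration by a fixed multiple of \<open>\<parallel>\<Delta>u\<parallel>\<^sup>2\<close>
    (\<open>sufficient_descent\<close>). Monotonicity of the subdifferentials between an iterate and \<open>u\<^sup>*\<close> gives a
    decrease that still contains the cross term \<open>\<langle>B\<^sup>*\<Delta>z, r\<rangle>\<close> (\<open>\<Phi>_step\<close>); monotonicity between two
    consecutive iterates of \<open>z\<close> trades it for a cross term with the previous \<open>r\<close>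
    (\<open>consecutive_z_steps\<close>), and Young's inequality with weights adapted to \<open>\<tau>\<close> absorbs the latter
    (\<open>relaxation_young\<close>). What remains is positive exactly because \<open>\<tau>\<^sup>2 < \<tau> + 1\<close>. The definiteness of
    \<open>\<Sigma> + S + \<sigma>AA\<^sup>*\<close> and \<open>\<Sigma> + T + \<sigma>BB\<^sup>*\<close> turns the remaining seminorms into the norm of \<open>\<Delta>u\<close>.

  \<^item> The residual is small. The optimality conditions of the subproblems differ from the KKT system only
    by linear expressions in \<open>\<Delta>u\<close>, and the proximal mapping is nonexpansive, so \<open>\<parallel>R(u)\<parallel>\<close> is at most a
    multiple of \<open>\<parallel>\<Delta>u\<parallel>\<close> (\<open>residual_le_step\<close>).

  \<^item> The residual controls the distance. A piecewise polyhedral mapping satisfies an error bound on every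
    bounded set (\<open>piecewise_polyhedral_error_bound\<close>), and the first estimate keeps the iterates bounded. Hence
    the distance from \<open>u\<close> to the KKT set is at most a multiple of \<open>\<parallel>R(u)\<parallel>\<close>.

  So the new energy, with the \<open>M\<close>-distance now taken to the whole KKT set, is at most \<open>P \<parallel>\<Delta>u\<parallel>\<^sup>2\<close>, while it is
  at most the old energy minus \<open>\<kappa> \<parallel>\<Delta>u\<parallel>\<^sup>2\<close>. Eliminating \<open>\<parallel>\<Delta>u\<parallel>\<^sup>2\<close> yields the factor \<open>P / (P + \<kappa>)\<close>.
\<close>

section \<open>Error bounds for polyhedral mappings\<close>

text \<open>Hoffman's bound for one additional inequality. The vertices split into those satisfying the inequality
  and those violating it, and each point \<open>p\<close> lies on a segment between the convex hulls of the two groups.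
  Moving \<open>p\<close> along this segment to the hyperplane costs at most its violation times \<open>D / \<alpha>\<close>, with \<open>D\<close> the
  diameter and \<open>\<alpha>\<close> the least violation at a violating vertex.\<close>
lemma polytope_halfspace_error_bound:
  fixes P :: "'a::euclidean_space set"
  assumes "polytope P" and "\<exists>p\<in>P. a \<bullet> p \<le> b"
  shows "\<exists>\<eta>\<ge>0. \<forall>p\<in>P. \<exists>q\<in>P. a \<bullet> q \<le> b \<and> norm (q - p) \<le> \<eta> * max 0 (a \<bullet> p - b)"
proof -
  obtain V where V: "finite V" "P = convex hull V"
    using assms(1) unfolding polytope_def by blast
  define V1 where "V1 = {v \<in> V. a \<bullet> v > b}"
  define V0 where "V0 = {v \<in> V. a \<bullet> v \<le> b}"
  have fin: "finite V1" "finite V0" and VU: "V = V0 \<union> V1"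
    using V by (auto simp: V0_def V1_def)
  have "convex P" using V by simp
  show ?thesis
  proof (cases "V1 = {}")
    case True
    then have "V \<subseteq> {p. a \<bullet> p \<le> b}" by (auto simp: V1_def)
    then have "P \<subseteq> {p. a \<bullet> p \<le> b}"
      using V(2) by (simp add: convex_halfspace_le hull_minimal)
    then show ?thesis by (intro exI[of _ 0]) auto
  next
    case V1: False
    have V0: "V0 \<noteq> {}"
    proof
      assume "V0 = {}"
      then have "V \<subseteq> {p. a \<bullet> p > b}" by (auto simp: V0_def)
      then have "P \<subseteq> {p. a \<bullet> p > b}"
        using V(2) by (simp add: convex_halfspace_gt hull_minimal)
      then show False using assms(2) by force
    qed
    define \<alpha> where "\<alpha> = Min ((\<lambda>v. a \<bullet> v - b) ` V1)"
    have \<alpha>: "\<alpha> > 0" unfolding \<alpha>_def using fin V1 by (subst Min_gr_iff) (auto simp: V1_def)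
    have "V1 \<subseteq> {p. a \<bullet> p \<ge> b + \<alpha>}"
    proof
      fix v assume "v \<in> V1"
      then have "\<alpha> \<le> a \<bullet> v - b" unfolding \<alpha>_def using fin by (intro Min_le) auto
      then show "v \<in> {p. a \<bullet> p \<ge> b + \<alpha>}" by simp
    qed
    then have H1: "convex hull V1 \<subseteq> {p. a \<bullet> p \<ge> b + \<alpha>}"
      by (simp add: convex_halfspace_ge hull_minimal)
    have H0: "convex hull V0 \<subseteq> {p. a \<bullet> p \<le> b}"
      by (rule hull_minimal) (auto simp: V0_def convex_halfspace_le)
    have bnd: "bounded P" using assms(1) polytope_imp_bounded by blast
    define D where "D = diameter P"
    have D: "norm (p - q) \<le> D" if "p \<in> P" "q \<in> P" for p q
      using diameter_bounded_bound[OF bnd that] by (simp add: D_def dist_norm)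
    have "D \<ge> 0" unfolding D_def using bnd by (rule diameter_ge_0)
    show ?thesis
    proof (intro exI[of _ "D / \<alpha>"] conjI ballI)
      show "D / \<alpha> \<ge> 0" using \<open>D \<ge> 0\<close> \<alpha> by simp
      fix p assume p: "p \<in> P"
      show "\<exists>q\<in>P. a \<bullet> q \<le> b \<and> norm (q - p) \<le> D / \<alpha> * max 0 (a \<bullet> p - b)"
      proof (cases "a \<bullet> p \<le> b")
        case True
        then show ?thesis using p \<open>D \<ge> 0\<close> \<alpha> by (intro bexI[of _ p]) auto
      next
        case False
        have "p \<in> convex hull ((convex hull V0) \<union> (convex hull V1))"
          using p unfolding V(2) VU
          by (metis hull_Un_left hull_Un_right)
        then obtain u' u p0 p1 where "0 \<le> u'" "0 \<le> u" "u' + u = 1"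
          and p0: "p0 \<in> convex hull V0" and p1: "p1 \<in> convex hull V1"
          and "p = u' *\<^sub>R p0 + u *\<^sub>R p1"
          using convex_hull_union_two[of "convex hull V0" "convex hull V1"] V0 V1 by auto
        moreover from this have "u' = 1 - u" by simp
        ultimately have u: "0 \<le> u" "u \<le> 1" and pp: "p = (1 - u) *\<^sub>R p0 + u *\<^sub>R p1"
          by simp_all
        have "p0 \<in> P" "p1 \<in> P"
          using p0 p1 V(2) VU hull_mono[of V0 V convex] hull_mono[of V1 V convex] by auto
        define l0 where "l0 = a \<bullet> p0 - b"
        define l1 where "l1 = a \<bullet> p1 - b"
        have l: "l0 \<le> 0" "l1 \<ge> \<alpha>" using p0 p1 H0 H1 by (auto simp: l0_def l1_def)
        \<comment> \<open>the parameter at which the segment from \<open>p0\<close> to \<open>p1\<close> crosses the hyperplane\<close>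
        define w where "w = - l0 / (l1 - l0)"
        have pos: "l1 - l0 > 0" using l \<alpha> by linarith
        have w: "0 \<le> w" "w \<le> 1" using l \<alpha> pos by (auto simp: w_def divide_simps)
        define q where "q = (1 - w) *\<^sub>R p0 + w *\<^sub>R p1"
        have lp: "a \<bullet> p - b = l0 + u * (l1 - l0)"
          by (simp add: pp l0_def l1_def inner_add_right inner_diff_right algebra_simps)
        have "a \<bullet> q - b = l0 + w * (l1 - l0)"
          by (simp add: q_def l0_def l1_def inner_add_right inner_diff_right algebra_simps)
        also have "\<dots> = 0" using pos by (simp add: w_def field_simps)
        finally have lq: "a \<bullet> q = b" by simp
        have "q \<in> P" unfolding q_def
          using \<open>convex P\<close> \<open>p0 \<in> P\<close> \<open>p1 \<in> P\<close> w by (intro convexD) auto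
        have uw: "u - w = (a \<bullet> p - b) / (l1 - l0)"
          using pos unfolding lp by (simp add: w_def field_simps)
        then have uw0: "u - w \<ge> 0" using False pos by simp
        have "q - p = (u - w) *\<^sub>R (p0 - p1)" by (simp add: q_def pp algebra_simps)
        then have "norm (q - p) = (u - w) * norm (p0 - p1)" using uw0 by simp
        also have "\<dots> \<le> (u - w) * D" using D[OF \<open>p0 \<in> P\<close> \<open>p1 \<in> P\<close>] uw0 by (rule mult_left_mono)
        also have "\<dots> \<le> ((a \<bullet> p - b) / \<alpha>) * D"
          unfolding uw using l \<alpha> False \<open>D \<ge> 0\<close> pos
          by (intro mult_right_mono divide_left_mono) auto
        finally show ?thesis using \<open>q \<in> P\<close> lq False by (intro bexI[of _ q]) (auto simp: field_simps)
      qed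
    qed
  qed
qed

text \<open>Inequalities are imposed one at a time: cutting a polytope with a halfspace leaves a polytope, and the
  correction made for one inequality worsens the violation of the others by at most a constant factor.\<close>
lemma polytope_halfspaces_error_bound:
  fixes P :: "'a::euclidean_space set" and F :: "('a \<times> real) set"
  assumes "finite F" and "polytope P" and "\<exists>p\<in>P. \<forall>(a, b)\<in>F. a \<bullet> p \<le> b"
  shows "\<exists>\<eta>\<ge>0. \<forall>p\<in>P. \<forall>\<delta>\<ge>0. (\<forall>(a, b)\<in>F. a \<bullet> p \<le> b + \<delta>) \<longrightarrow>
           (\<exists>q\<in>P. (\<forall>(a, b)\<in>F. a \<bullet> q \<le> b) \<and> norm (q - p) \<le> \<eta> * \<delta>)"
  using assms
proof (induction F arbitrary: P rule: finite_induct)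
  case empty
  show ?case by (intro exI[of _ 0]) auto
next
  case (insert ab F)
  obtain a b where ab: "ab = (a, b)" by force
  define Q where "Q = P \<inter> {p. a \<bullet> p \<le> b}"
  have Q: "polytope Q" unfolding Q_def
    using insert.prems(1) polyhedron_halfspace_le by (rule polytope_Int_polyhedron)
  have "\<exists>p\<in>Q. \<forall>(a, b)\<in>F. a \<bullet> p \<le> b" using insert.prems(2) by (auto simp: Q_def ab)
  from insert.IH[OF Q this] obtain \<eta>2 where e2: "\<eta>2 \<ge> 0"
    "\<And>p \<delta>. p \<in> Q \<Longrightarrow> \<delta> \<ge> 0 \<Longrightarrow> \<forall>(a, b)\<in>F. a \<bullet> p \<le> b + \<delta> \<Longrightarrow>
       \<exists>q\<in>Q. (\<forall>(a, b)\<in>F. a \<bullet> q \<le> b) \<and> norm (q - p) \<le> \<eta>2 * \<delta>" by blast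
  have "\<exists>p\<in>P. a \<bullet> p \<le> b" using insert.prems(2) by (auto simp: ab)
  from polytope_halfspace_error_bound[OF insert.prems(1) this] obtain \<eta>1 where e1: "\<eta>1 \<ge> 0"
    "\<And>p. p \<in> P \<Longrightarrow> \<exists>q\<in>P. a \<bullet> q \<le> b \<and> norm (q - p) \<le> \<eta>1 * max 0 (a \<bullet> p - b)" by blast
  define N where "N = (\<Sum>(a, b)\<in>F. norm a)"
  have N: "norm c \<le> N" if "(c, d) \<in> F" for c d
  proof -
    have "(\<lambda>(a, b). norm a) (c, d) \<le> N" unfolding N_def
      using insert.hyps(1) that by (intro member_le_sum) auto
    then show ?thesis by simp
  qed
  have N0: "N \<ge> 0" unfolding N_def by (intro sum_nonneg) auto
  show ?case
  proof (intro exI[of _ "\<eta>1 + \<eta>2 * (1 + N * \<eta>1)"] conjI ballI allI impI)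
    show "0 \<le> \<eta>1 + \<eta>2 * (1 + N * \<eta>1)" using e1(1) e2(1) N0 by simp
    fix p \<delta> assume p: "p \<in> P" and \<delta>: "0 \<le> (\<delta>::real)"
      and le: "\<forall>(a, b)\<in>insert ab F. a \<bullet> p \<le> b + \<delta>"
    obtain q where q: "q \<in> P" "a \<bullet> q \<le> b" "norm (q - p) \<le> \<eta>1 * max 0 (a \<bullet> p - b)"
      using e1(2)[OF p] by blast
    have "\<eta>1 * max 0 (a \<bullet> p - b) \<le> \<eta>1 * \<delta>"
      using le \<delta> e1(1) by (intro mult_left_mono) (auto simp: ab)
    with q(3) have qp: "norm (q - p) \<le> \<eta>1 * \<delta>" by linarith
    have "c \<bullet> q \<le> d + (1 + N * \<eta>1) * \<delta>" if "(c, d) \<in> F" for c d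
    proof -
      have "c \<bullet> (q - p) \<le> norm c * norm (q - p)" by (rule norm_cauchy_schwarz)
      also have "\<dots> \<le> N * (\<eta>1 * \<delta>)" using N[OF that] qp N0 by (intro mult_mono) auto
      finally have "c \<bullet> q \<le> c \<bullet> p + N * (\<eta>1 * \<delta>)" by (simp add: inner_diff_right)
      moreover have "c \<bullet> p \<le> d + \<delta>" using le that by auto
      ultimately show ?thesis by (simp add: algebra_simps)
    qed
    then obtain r where r: "r \<in> Q" "\<forall>(a, b)\<in>F. a \<bullet> r \<le> b"
      "norm (r - q) \<le> \<eta>2 * ((1 + N * \<eta>1) * \<delta>)"
      using e2(2)[of q "(1 + N * \<eta>1) * \<delta>"] q \<delta> e1(1) N0 by (auto simp: Q_def)
    have "norm (r - p) \<le> norm (r - q) + norm (q - p)" by (rule norm_diff_triangle_ineq[of r q q p, simplified])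
    then have "norm (r - p) \<le> (\<eta>1 + \<eta>2 * (1 + N * \<eta>1)) * \<delta>"
      using r(3) qp by (simp add: algebra_simps)
    then show "\<exists>q\<in>P. (\<forall>(a, b)\<in>insert ab F. a \<bullet> q \<le> b)
        \<and> norm (q - p) \<le> (\<eta>1 + \<eta>2 * (1 + N * \<eta>1)) * \<delta>"
      using r by (intro bexI[of _ r]) (auto simp: Q_def ab)
  qed
qed

text \<open>The section \<open>v = 0\<close> is cut out by the inequalities \<open>\<plusminus>v\<^sub>b \<le> 0\<close> over the basis vectors \<open>b\<close>, each violated
  by at most \<open>\<parallel>v\<parallel>\<close>.\<close>
lemma polytope_zero_section_error_bound:
  fixes P :: "('a::euclidean_space \<times> 'b::euclidean_space) set"
  assumes "polytope P" and "\<exists>u. (u, 0) \<in> P"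
  shows "\<exists>\<eta>\<ge>0. \<forall>(u, v)\<in>P. \<exists>u'. (u', 0) \<in> P \<and> norm (u' - u) \<le> \<eta> * norm v"
proof -
  define F :: "(('a \<times> 'b) \<times> real) set"
    where "F = (\<lambda>b. ((0, b), 0)) ` Basis \<union> (\<lambda>b. ((0, - b), 0)) ` Basis"
  have "finite F" by (simp add: F_def)
  have F: "(\<forall>(a, r)\<in>F. a \<bullet> (u, v) \<le> r + \<delta>) \<longleftrightarrow> (\<forall>b\<in>Basis. \<bar>v \<bullet> b\<bar> \<le> \<delta>)" for u v \<delta>
    unfolding F_def ball_Un ball_simps
    by (simp add: inner_commute[of v] abs_le_iff ball_conj_distrib)
  have F0: "v = 0" if "\<forall>(a, b)\<in>F. a \<bullet> (u, v) \<le> b" for u v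
  proof (rule euclidean_eqI)
    fix b :: 'b assume "b \<in> Basis"
    then show "v \<bullet> b = 0 \<bullet> b" using F[of u v 0] that by simp
  qed
  obtain \<eta> where \<eta>: "\<eta> \<ge> 0" "\<forall>p\<in>P. \<forall>\<delta>\<ge>0. (\<forall>(a, b)\<in>F. a \<bullet> p \<le> b + \<delta>) \<longrightarrow>
           (\<exists>q\<in>P. (\<forall>(a, b)\<in>F. a \<bullet> q \<le> b) \<and> norm (q - p) \<le> \<eta> * \<delta>)"
  proof -
    obtain u0 where "(u0, 0) \<in> P" using assms(2) by blast
    then have "\<exists>p\<in>P. \<forall>(a, b)\<in>F. a \<bullet> p \<le> b" using F[of u0 0 0] by (intro bexI) simp_all
    from polytope_halfspaces_error_bound[OF \<open>finite F\<close> assms(1) this] show ?thesis using that by blast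
  qed
  have "\<exists>u'. (u', 0) \<in> P \<and> norm (u' - u) \<le> \<eta> * norm v" if uv: "(u, v) \<in> P" for u v
  proof -
    have "\<forall>(a, b)\<in>F. a \<bullet> (u, v) \<le> b + norm v"
      unfolding F by (simp add: Basis_le_norm)
    from \<eta>(2)[THEN bspec, OF uv, THEN spec, THEN mp, THEN mp, OF norm_ge_zero this]
    obtain q where q: "q \<in> P" "\<forall>(a, b)\<in>F. a \<bullet> q \<le> b" "norm (q - (u, v)) \<le> \<eta> * norm v"
      by blast
    obtain u' v' where "q = (u', v')" by force
    moreover have "v' = 0" using F0 q(2) calculation by blast
    moreover have "norm (u' - u) \<le> norm (q - (u, v))"
      using norm_fst_le[of "u' - u" "v' - v"] calculation by simp
    ultimately show ?thesis using q by (intro exI[of _ u']) simp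
  qed
  then show ?thesis using \<eta>(1)
    by (intro exI[of _ \<eta>]) (simp add: Ball_def split_paired_All)
qed

text \<open>Boundedness of \<open>K\<close> is used twice. Intersected with a box around \<open>K\<close>, every polyhedral piece of the graph
  becomes a polytope; and a piece that misses \<open>v = 0\<close> inside the box stays at a positive distance from it, so that
  for such a piece any fixed zero \<open>u0\<close> of the mapping serves as the nearby point.\<close>
lemma piecewise_polyhedral_error_bound:
  fixes F :: "'a::euclidean_space \<Rightarrow> 'b::euclidean_space set"
  assumes pp: "piecewise_polyhedral F" and ne: "\<exists>u. 0 \<in> F u" and bnd: "bounded K"
  shows "\<exists>\<eta>\<ge>0. \<forall>u v. v \<in> F u \<and> (u, v) \<in> K \<longrightarrow> (\<exists>u'. 0 \<in> F u' \<and> norm (u' - u) \<le> \<eta> * norm v)"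
proof -
  obtain \<P> where \<P>: "finite \<P>" "\<And>Q. Q \<in> \<P> \<Longrightarrow> polyhedron Q" "{(u, v). v \<in> F u} = \<Union>\<P>"
    using pp unfolding piecewise_polyhedral_def by blast
  obtain u0 where u0: "0 \<in> F u0" using ne by blast
  obtain C where C: "polytope C" "K \<subseteq> C"
    using bounded_subset_cbox_symmetric[OF bnd] polytope_interval by metis
  have piece: "\<exists>\<eta>\<ge>0. \<forall>u v. (u, v) \<in> Q \<inter> C \<longrightarrow> (\<exists>u'. 0 \<in> F u' \<and> norm (u' - u) \<le> \<eta> * norm v)"
    if Q: "Q \<in> \<P>" for Q
  proof -
    define W where "W = Q \<inter> C"
    have W: "polytope W" unfolding W_def
      using polytope_Int_polyhedron[OF C(1) \<P>(2)[OF Q]] by (simp add: Int_commute)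
    have sub: "v \<in> F u" if "(u, v) \<in> W" for u v using that Q \<P>(3) by (auto simp: W_def)
    show ?thesis
    proof (cases "\<exists>u. (u, 0) \<in> W")
      case True
      from polytope_zero_section_error_bound[OF W this] obtain \<eta> where "\<eta> \<ge> 0"
        and \<eta>: "\<forall>(u, v)\<in>W. \<exists>u'. (u', 0) \<in> W \<and> norm (u' - u) \<le> \<eta> * norm v"
        by (elim exE conjE)
      have "\<exists>u'. 0 \<in> F u' \<and> norm (u' - u) \<le> \<eta> * norm v" if "(u, v) \<in> W" for u v
        using bspec[OF \<eta> that] sub by auto
      then show ?thesis using \<open>\<eta> \<ge> 0\<close> unfolding W_def[symmetric] by auto
    next
      case False
      have cW: "compact W" using W polytope_imp_compact by blast
      show ?thesis
      proof (cases "W = {}")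
        case True then show ?thesis unfolding W_def[symmetric] by (intro exI[of _ 0]) simp
      next
        case ne: False
        have "continuous_on W (\<lambda>w. norm (snd w))" by (intro continuous_intros)
        from continuous_attains_inf[OF cW ne this] obtain w0 where
          w0: "w0 \<in> W" "\<And>w. w \<in> W \<Longrightarrow> norm (snd w0) \<le> norm (snd w)" by blast
        have d: "norm (snd w0) > 0" using False w0(1) by (metis norm_ge_zero norm_eq_zero order_le_less prod.collapse)
        obtain b where b: "b > 0" "\<And>w. w \<in> W \<Longrightarrow> norm w \<le> b"
          using compact_imp_bounded[OF cW] by (metis bounded_pos)
        have *: "norm (u0 - u) \<le> ((norm u0 + b) / norm (snd w0)) * norm v" if "(u, v) \<in> W" for u v
        proof -
          have "norm (u0 - u) \<le> norm u0 + norm u" by (rule norm_triangle_ineq4)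
          also have "norm u \<le> b" using b(2)[OF that] norm_fst_le[of u v] by linarith
          also have "norm u0 + b \<le> (norm u0 + b) * (norm v / norm (snd w0))"
            using mult_left_mono[of 1 "norm v / norm (snd w0)" "norm u0 + b"] w0(2)[OF that] d b(1)
            by (simp add: add_nonneg_nonneg)
          finally show ?thesis by (simp add: field_simps)
        qed
        moreover have "(norm u0 + b) / norm (snd w0) \<ge> 0" using b(1) by simp
        ultimately show ?thesis unfolding W_def[symmetric]
          by (intro exI[of _ "(norm u0 + b) / norm (snd w0)"] conjI allI impI exI[of _ u0] u0 *)
      qed
    qed
  qed
  obtain \<eta> where \<eta>: "\<forall>Q\<in>\<P>. \<eta> Q \<ge> 0 \<and> (\<forall>u v. (u, v) \<in> Q \<inter> C \<longrightarrow>
      (\<exists>u'. 0 \<in> F u' \<and> norm (u' - u) \<le> \<eta> Q * norm v))"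
    by (rule exE[OF bchoice[OF ballI[OF piece]]])
  have \<eta>0: "\<eta> Q \<ge> 0" if "Q \<in> \<P>" for Q
    using bspec[OF \<eta> that] by (rule conjunct1)
  have \<eta>1: "\<exists>u'. 0 \<in> F u' \<and> norm (u' - u) \<le> \<eta> Q * norm v"
    if "Q \<in> \<P>" "(u, v) \<in> Q \<inter> C" for Q u v
    using bspec[OF \<eta> that(1), THEN conjunct2, THEN spec, THEN spec, THEN mp, OF that(2)] .
  have "\<exists>u'. 0 \<in> F u' \<and> norm (u' - u) \<le> (\<Sum>Q\<in>\<P>. \<eta> Q) * norm v" if "v \<in> F u" "(u, v) \<in> K" for u v
  proof -
    have "(u, v) \<in> \<Union>\<P>" using that(1) unfolding \<P>(3)[symmetric] by simp
    then obtain Q where Q: "Q \<in> \<P>" "(u, v) \<in> Q" by (elim UnionE)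
    then have "(u, v) \<in> Q \<inter> C" using that(2) C(2) by blast
    from \<eta>1[OF Q(1) this] obtain u' where u': "0 \<in> F u'" "norm (u' - u) \<le> \<eta> Q * norm v"
      by (elim exE conjE)
    have "\<eta> Q \<le> (\<Sum>Q\<in>\<P>. \<eta> Q)" using \<P>(1) Q(1) \<eta>0 by (intro member_le_sum) auto
    then have "\<eta> Q * norm v \<le> (\<Sum>Q\<in>\<P>. \<eta> Q) * norm v" by (intro mult_right_mono) auto
    then show ?thesis using u' by (intro exI[of _ u']) simp
  qed
  moreover have "(\<Sum>Q\<in>\<P>. \<eta> Q) \<ge> 0" using \<eta>0 by (intro sum_nonneg)
  ultimately show ?thesis by (intro exI[of _ "\<Sum>Q\<in>\<P>. \<eta> Q"]) simp
qed

section \<open>Subgradients and the proximal mapping\<close>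

text \<open>One-sided difference quotients suffice for optimality and convexity arguments, since convex combinations
  only allow steps \<open>t > 0\<close>.\<close>
lemma GDERIV_tendsto_right:
  fixes q :: "'a::euclidean_space \<Rightarrow> real"
  assumes "GDERIV q v :> d"
  shows "((\<lambda>t. (q (v + t *\<^sub>R (w - v)) - q v) / t) \<longlongrightarrow> d \<bullet> (w - v)) (at_right 0)"
proof -
  have "(q has_derivative (\<lambda>k. k \<bullet> d)) (at (v + 0 *\<^sub>R (w - v)))"
    using assms by (simp add: gderiv_def)
  moreover have "((\<lambda>t. v + t *\<^sub>R (w - v)) has_derivative (\<lambda>t. t *\<^sub>R (w - v))) (at 0)"
    by (auto intro!: derivative_eq_intros)
  ultimately have "((\<lambda>t. q (v + t *\<^sub>R (w - v))) has_derivative (\<lambda>t. (t *\<^sub>R (w - v)) \<bullet> d)) (at 0)"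
    using has_derivative_compose by fastforce
  moreover have "(\<lambda>t. (t *\<^sub>R (w - v)) \<bullet> d) = (*) (d \<bullet> (w - v))"
    by (simp add: fun_eq_iff inner_commute)
  ultimately have "((\<lambda>t. q (v + t *\<^sub>R (w - v))) has_real_derivative d \<bullet> (w - v)) (at 0)"
    by (simp only: has_field_derivative_def)
  then have "((\<lambda>t. (q (v + t *\<^sub>R (w - v)) - q v) / t) \<longlongrightarrow> d \<bullet> (w - v)) (at 0)"
    by (simp add: has_field_derivative_iff)
  then show ?thesis by (rule tendsto_mono[rotated]) (simp add: at_le)
qed

lemma convex_gradient_le:
  fixes q :: "'a::euclidean_space \<Rightarrow> real"
  assumes "convex_on UNIV q" and "GDERIV q v :> d"
  shows "q v + d \<bullet> (w - v) \<le> q w"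
proof -
  have "\<forall>\<^sub>F t in at_right (0::real). t \<in> {0<..<1}" by (rule eventually_at_right_real) simp
  then have "\<forall>\<^sub>F t in at_right (0::real). (q (v + t *\<^sub>R (w - v)) - q v) / t \<le> q w - q v"
  proof eventually_elim
    case (elim t)
    have "q ((1 - t) *\<^sub>R v + t *\<^sub>R w) \<le> (1 - t) * q v + t * q w"
      using elim assms(1) by (intro convex_onD) auto
    moreover have "(1 - t) *\<^sub>R v + t *\<^sub>R w = v + t *\<^sub>R (w - v)" by (simp add: algebra_simps)
    ultimately show ?case using elim by (simp add: field_simps)
  qed
  from tendsto_upperbound[OF GDERIV_tendsto_right[OF assms(2)] this]
  show ?thesis by simp
qed

lemma cont_diff_convex_GDERIV:
  assumes "cont_diff_convex g"
  shows "GDERIV g v :> grad g v"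
proof -
  obtain D where D: "(g has_derivative D) (at v)"
    using assms by (auto simp: cont_diff_convex_def differentiable_on_def differentiable_def)
  define d where "d = (\<Sum>b\<in>Basis. D b *\<^sub>R b)"
  have "linear D" using D has_derivative_linear by blast
  have "D k = k \<bullet> d" for k
  proof -
    have "D k = D (\<Sum>b\<in>Basis. (k \<bullet> b) *\<^sub>R b)" by (simp add: euclidean_representation)
    also have "\<dots> = (\<Sum>b\<in>Basis. (k \<bullet> b) * D b)"
      using \<open>linear D\<close> by (simp add: linear_sum linear_cmul)
    finally show ?thesis by (simp add: d_def inner_sum_right mult.commute)
  qed
  then have "D = (\<lambda>k. k \<bullet> d)" by (rule ext)
  then have ex: "GDERIV g v :> d" using D unfolding gderiv_def by simp
  show ?thesis unfolding grad_def
  proof (rule theI)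
    show "GDERIV g v :> d" by (rule ex)
    fix d' assume "GDERIV g v :> d'"
    then have "(\<lambda>k. k \<bullet> d') = (\<lambda>k. k \<bullet> d)"
      using ex unfolding gderiv_def by (rule has_derivative_unique)
    then show "d' = d" by (simp add: fun_eq_iff vector_eq_ldot)
  qed
qed

lemma proper_closed_convex_finite:
  assumes "proper_closed_convex f" and "f v \<noteq> \<infinity>"
  obtains a where "f v = ereal a"
  using assms by (cases "f v") (auto simp: proper_closed_convex_def)

lemma proper_point:
  assumes "proper_closed_convex f"
  obtains v a where "f v = ereal a"
  using assms by (meson proper_closed_convex_def proper_closed_convex_finite)

lemma subdiff_finite:
  assumes "proper_closed_convex f" and "\<xi> \<in> subdiff f v"
  shows "f v \<noteq> \<infinity>"
proof
  assume "f v = \<infinity>"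
  have "f w = \<infinity>" for w
  proof -
    have "f v + ereal (\<xi> \<bullet> (w - v)) \<le> f w" using assms(2) unfolding subdiff_def by blast
    then show ?thesis using \<open>f v = \<infinity>\<close> by simp
  qed
  then show False using assms(1) by (auto simp: proper_closed_convex_def)
qed

text \<open>Fermat's rule for a convex function plus a differentiable one: compare \<open>v\<close> with \<open>v + t(w - v)\<close>, bound the
  convex part by its chord, divide by \<open>t\<close> and let \<open>t\<close> tend to \<open>0\<close>.\<close>
lemma minimizer_imp_subgradient:
  fixes f :: "'a::euclidean_space \<Rightarrow> ereal" and q :: "'a \<Rightarrow> real"
  assumes f: "proper_closed_convex f"
    and min: "\<And>w. f v + ereal (q v) \<le> f w + ereal (q w)"
    and q: "GDERIV q v :> d"
  shows "- d \<in> subdiff f v"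
proof -
  obtain w0 where "f w0 \<noteq> \<infinity>" using f by (auto simp: proper_closed_convex_def)
  then have "f v \<noteq> \<infinity>" using min[of w0] by auto
  then obtain a where a: "f v = ereal a" using f proper_closed_convex_finite by blast
  have "f v + ereal (- d \<bullet> (w - v)) \<le> f w" for w
  proof (cases "f w = \<infinity>")
    case False
    then obtain b where b: "f w = ereal b" using f proper_closed_convex_finite by blast
    have "\<forall>\<^sub>F t in at_right (0::real). t \<in> {0<..<1}" by (rule eventually_at_right_real) simp
    then have "\<forall>\<^sub>F t in at_right (0::real). a - b \<le> (q (v + t *\<^sub>R (w - v)) - q v) / t"
    proof eventually_elim
      case (elim t)
      have "convex {(v, r::real). f v \<le> ereal r}" using f by (simp add: proper_closed_convex_def)
      then have "(1 - t) *\<^sub>R (v, a) + t *\<^sub>R (w, b) \<in> {(v, r::real). f v \<le> ereal r}"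
        using elim by (intro convexD) (auto simp: a b)
      moreover have "(1 - t) *\<^sub>R v + t *\<^sub>R w = v + t *\<^sub>R (w - v)" by (simp add: algebra_simps)
      ultimately have "f (v + t *\<^sub>R (w - v)) \<le> ereal ((1 - t) * a + t * b)" by simp
      then have "f (v + t *\<^sub>R (w - v)) + ereal (q (v + t *\<^sub>R (w - v)))
          \<le> ereal ((1 - t) * a + t * b) + ereal (q (v + t *\<^sub>R (w - v)))" by (rule add_right_mono)
      with min[of "v + t *\<^sub>R (w - v)"] have "a + q v \<le> (1 - t) * a + t * b + q (v + t *\<^sub>R (w - v))"
        unfolding a by (metis ereal_less_eq(3) order_trans plus_ereal.simps(1))
      then show ?case using elim by (simp add: field_simps)
    qed
    from tendsto_lowerbound[OF GDERIV_tendsto_right[OF q] this] have "a - b \<le> d \<bullet> (w - v)" by simp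
    then show ?thesis by (simp add: a b)
  qed simp
  then show ?thesis by (simp add: subdiff_def)
qed

lemma subdiff_plus_smooth:
  assumes f: "proper_closed_convex f" and g: "cont_diff_convex g" and \<xi>: "\<xi> \<in> subdiff f v"
  shows "\<xi> + grad g v \<in> subdiff (plus_smooth f g) v"
proof -
  obtain a where a: "f v = ereal a"
    using subdiff_finite[OF f \<xi>] proper_closed_convex_finite[OF f] by blast
  have "plus_smooth f g v + ereal ((\<xi> + grad g v) \<bullet> (w - v)) \<le> plus_smooth f g w" for w
  proof (cases "f w = \<infinity>")
    case False
    then obtain b where b: "f w = ereal b" using proper_closed_convex_finite[OF f] by blast
    have "g v + grad g v \<bullet> (w - v) \<le> g w"
      using g cont_diff_convex_GDERIV[OF g]
      by (intro convex_gradient_le) (simp_all only: cont_diff_convex_def)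
    moreover have "f v + ereal (\<xi> \<bullet> (w - v)) \<le> f w" using \<xi> unfolding subdiff_def by blast
    ultimately show ?thesis by (simp add: plus_smooth_def a b inner_add_left)
  qed (simp add: plus_smooth_def)
  then show ?thesis by (simp add: subdiff_def)
qed

lemma subdiff_monotone:
  assumes f: "proper_closed_convex f" and s: "\<xi> \<in> subdiff f v" "\<xi>' \<in> subdiff f v'"
  shows "(\<xi>' - \<xi>) \<bullet> (v' - v) \<ge> 0"
proof -
  obtain a where a: "f v = ereal a"
    using subdiff_finite[OF f s(1)] proper_closed_convex_finite[OF f] by blast
  obtain a' where a': "f v' = ereal a'"
    using subdiff_finite[OF f s(2)] proper_closed_convex_finite[OF f] by blast
  have "f v + ereal (\<xi> \<bullet> (v' - v)) \<le> f v'" "f v' + ereal (\<xi>' \<bullet> (v - v')) \<le> f v"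
    using s unfolding subdiff_def by blast+
  then show ?thesis by (simp add: a a' inner_diff_left inner_diff_right)
qed

lemma GDERIV_half_dist_square:
  fixes v :: "'a::euclidean_space"
  shows "GDERIV (\<lambda>w. 1 / 2 * (norm (w - v))\<^sup>2) p :> p - v"
proof -
  have "((\<lambda>w. w - v) has_derivative (\<lambda>k. k)) (at p)" by (auto intro!: derivative_eq_intros)
  from has_derivative_mult_right[OF has_derivative_inner[OF this this], of "1/2"]
  show ?thesis
    unfolding gderiv_def power2_norm_eq_inner by (simp add: inner_commute[of "p - v"])
qed

text \<open>Existence of the proximal point. A single subgradient supplies an affine minorant of \<open>f\<close>, which makes
  \<open>J(w, r) = r + \<parallel>w - v\<parallel>\<^sup>2 / 2\<close> coercive on the closed epigraph of \<open>f\<close>; minimizing over the epigraph keeps the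
  argument within real numbers.\<close>
lemma prox_minimizes:
  fixes f :: "'a::euclidean_space \<Rightarrow> ereal"
  assumes f: "proper_closed_convex f" and \<xi>: "\<xi> \<in> subdiff f v0"
  shows "f (prox f v) + ereal (1/2 * (norm (prox f v - v))\<^sup>2) \<le> f w + ereal (1/2 * (norm (w - v))\<^sup>2)"
proof -
  define G where "G = {(w, r::real). f w \<le> ereal r}"
  define J where "J = (\<lambda>(w, r). r + 1/2 * (norm (w - v))\<^sup>2)"
  have G: "closed G" using f by (simp add: G_def proper_closed_convex_def)
  obtain a where a: "f v0 = ereal a"
    using subdiff_finite[OF f \<xi>] proper_closed_convex_finite[OF f] by blast
  have minor: "a + \<xi> \<bullet> (w - v0) \<le> r" if "(w, r) \<in> G" for w r
  proof -
    have "f v0 + ereal (\<xi> \<bullet> (w - v0)) \<le> f w" using \<xi> unfolding subdiff_def by blast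
    also have "\<dots> \<le> ereal r" using that by (simp add: G_def)
    finally show ?thesis by (simp add: a)
  qed
  define C where "C = G \<inter> {p. J p \<le> J (v0, a)}"
  have contJ: "continuous_on UNIV J" unfolding J_def case_prod_beta by (intro continuous_intros)
  have "closed {p. J p \<le> J (v0, a)}"
    using contJ by (intro closed_Collect_le) auto
  then have "closed C" unfolding C_def using G by (intro closed_Int)
  moreover have "bounded C"
  proof -
    \<comment> \<open>On \<open>C\<close> the minorant gives \<open>n\<^sup>2 / 2 \<le> \<parallel>\<xi>\<parallel> n + c0\<close> for \<open>n = \<parallel>w - v\<parallel>\<close>, hence \<open>n\<^sup>2 \<le> N - 1\<close>.\<close>
    define c0 where "c0 = J (v0, a) - a - \<xi> \<bullet> (v - v0)"
    define N where "N = 4 * (c0 + (norm \<xi>)\<^sup>2) + 1"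
    have "p \<in> cball v N \<times> {a + \<xi> \<bullet> (v - v0) - norm \<xi> * N .. J (v0, a)}" if p: "p \<in> C" for p
    proof -
      obtain w r where wr: "p = (w, r)" by force
      define n where "n = norm (w - v)"
      have 1: "r + 1/2 * n\<^sup>2 \<le> J (v0, a)" "a + \<xi> \<bullet> (w - v0) \<le> r"
        using p minor by (auto simp: C_def wr J_def n_def)
      have "\<bar>\<xi> \<bullet> (w - v)\<bar> \<le> norm \<xi> * n" unfolding n_def by (rule Cauchy_Schwarz_ineq2)
      then have 2: "\<xi> \<bullet> (w - v0) \<ge> \<xi> \<bullet> (v - v0) - norm \<xi> * n" by (simp add: inner_diff_right)
      have 3: "norm \<xi> * n \<le> n\<^sup>2 / 4 + (norm \<xi>)\<^sup>2"
        using sum_squares_bound[of "n / 2" "norm \<xi>"] by (simp add: power2_eq_square algebra_simps)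
      have "n\<^sup>2 \<le> N - 1" using 1 2 3 unfolding N_def c0_def by (simp add: field_simps)
      moreover have "n \<le> n\<^sup>2 + 1"
        using zero_le_power2[of n] sum_squares_bound[of n 1] unfolding power_one mult_1_right by linarith
      ultimately have n: "n \<le> N" by simp
      moreover have "norm \<xi> * n \<le> norm \<xi> * N" using n by (intro mult_left_mono) auto
      moreover have "r \<le> J (v0, a)" using 1(1) zero_le_power2[of n] by linarith
      ultimately show ?thesis using 1 2 by (simp add: wr n_def dist_norm norm_minus_commute)
    qed
    then have "C \<subseteq> cball v N \<times> {a + \<xi> \<bullet> (v - v0) - norm \<xi> * N .. J (v0, a)}" by blast
    then show ?thesis by (rule bounded_subset[rotated]) (intro bounded_Times bounded_cball bounded_closed_interval)
  qed
  ultimately have "compact C" by (simp add: compact_eq_bounded_closed)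
  have v0C: "(v0, a) \<in> C" by (simp add: C_def G_def a)
  then have "C \<noteq> {}" by blast
  have "continuous_on C J" using contJ by (rule continuous_on_subset) simp
  from continuous_attains_inf[OF \<open>compact C\<close> \<open>C \<noteq> {}\<close> this]
  obtain p where p: "p \<in> C" "\<forall>p'\<in>C. J p \<le> J p'" by (elim bexE)
  obtain w0 r0 where wr: "p = (w0, r0)" by force
  let ?g = "\<lambda>w. f w + ereal (1/2 * (norm (w - v))\<^sup>2)"
  have "?g w0 \<le> ?g w" for w
  proof (cases "f w = \<infinity>")
    case False
    then obtain b where b: "f w = ereal b" using proper_closed_convex_finite[OF f] by blast
    have "J p \<le> J (w, b)"
    proof (cases "(w, b) \<in> C")
      case False
      then have "J (w, b) > J (v0, a)" by (auto simp: C_def G_def b)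
      then show ?thesis using bspec[OF p(2) v0C] by simp
    qed (rule bspec[OF p(2)])
    have "f w0 \<le> ereal r0" using p(1) by (simp add: C_def G_def wr)
    then have "?g w0 \<le> ereal r0 + ereal (1/2 * (norm (w0 - v))\<^sup>2)" by (rule add_right_mono)
    also have "\<dots> = ereal (J p)" by (simp add: J_def wr)
    also have "\<dots> \<le> ereal (J (w, b))" using \<open>J p \<le> J (w, b)\<close> by simp
    also have "\<dots> = ?g w" by (simp add: J_def b)
    finally show ?thesis .
  qed simp
  then have "is_arg_min ?g (\<lambda>_. True) w0" by (simp add: is_arg_min_linorder)
  then have "is_arg_min ?g (\<lambda>_. True) (prox f v)" unfolding prox_def arg_min_def by (rule someI)
  then show ?thesis by (simp add: is_arg_min_linorder)
qed

lemma prox_subgradient: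
  fixes f :: "'a::euclidean_space \<Rightarrow> ereal"
  assumes f: "proper_closed_convex f" and \<xi>: "\<xi> \<in> subdiff f v0"
  shows "v - prox f v \<in> subdiff f (prox f v)"
proof -
  have "- (prox f v - v) \<in> subdiff f (prox f v)"
    by (rule minimizer_imp_subgradient[OF f _ GDERIV_half_dist_square]) (rule prox_minimizes[OF f \<xi>])
  then show ?thesis by simp
qed

text \<open>Nonexpansiveness of the proximal mapping, using that \<open>w\<close> is the proximal point of \<open>w + \<xi>\<close>. In this form it
  measures how far a point with a known subgradient is from solving a proximal equation.\<close>
lemma prox_nonexpansive_subgradient:
  fixes f :: "'a::euclidean_space \<Rightarrow> ereal"
  assumes f: "proper_closed_convex f" and \<xi>: "\<xi> \<in> subdiff f w"
  shows "norm (w - prox f v) \<le> norm (w + \<xi> - v)"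
proof -
  define e where "e = w - prox f v"
  define s where "s = w + \<xi> - v"
  have "(v - prox f v - \<xi>) \<bullet> (prox f v - w) \<ge> 0"
    by (rule subdiff_monotone[OF f \<xi> prox_subgradient[OF f \<xi>]])
  moreover have "v - prox f v - \<xi> = e - s" "prox f v - w = - e" by (simp_all add: e_def s_def)
  ultimately have "e \<bullet> e \<le> s \<bullet> e" by (simp add: inner_diff_left)
  also have "\<dots> \<le> norm s * norm e" by (rule norm_cauchy_schwarz)
  finally have "norm e * norm e \<le> norm s * norm e" by (simp add: power2_norm_eq_inner flip: power2_eq_square)
  then have "norm e \<le> norm s" by (cases "e = 0") (simp_all add: mult_le_cancel_right)
  then show ?thesis by (simp add: e_def s_def)
qed

lemma prox_fixed_point_iff:
  fixes f :: "'a::euclidean_space \<Rightarrow> ereal"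
  assumes f: "proper_closed_convex f" and \<xi>: "\<xi> \<in> subdiff f v0"
  shows "v - prox f (v - d) = 0 \<longleftrightarrow> - d \<in> subdiff f v"
proof
  assume "v - prox f (v - d) = 0"
  then show "- d \<in> subdiff f v" using prox_subgradient[OF f \<xi>, of "v - d"] by simp
next
  assume "- d \<in> subdiff f v"
  from prox_nonexpansive_subgradient[OF f this, of "v - d"]
  show "v - prox f (v - d) = 0" by simp
qed

section \<open>Positive semidefinite quadratic forms\<close>

lemma pos_semidef_linear: "pos_semidef N \<Longrightarrow> linear N"
  by (simp add: pos_semidef_def self_adjoint_def)

lemma pos_semidef_nonneg: "pos_semidef N \<Longrightarrow> 0 \<le> v \<bullet> N v"
  by (simp add: pos_semidef_def)

lemma pos_semidef_commute:
  assumes "pos_semidef N"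
  shows "N v \<bullet> w = v \<bullet> N w"
  using adjoint_works[OF pos_semidef_linear[OF assms], of v w] assms
  by (simp add: pos_semidef_def self_adjoint_def)

lemma op_norm_square: "pos_semidef N \<Longrightarrow> (op_norm N v)\<^sup>2 = v \<bullet> N v"
  by (simp add: op_norm_def pos_semidef_nonneg)

lemma quadratic_form_diff:
  assumes "pos_semidef N"
  shows "(v - w) \<bullet> N (v - w) = v \<bullet> N v - 2 * (N w \<bullet> v) + w \<bullet> N w"
proof -
  have "(v - w) \<bullet> N (v - w) = v \<bullet> N v - v \<bullet> N w - (w \<bullet> N v - w \<bullet> N w)"
    unfolding linear_diff[OF pos_semidef_linear[OF assms]] by (simp add: inner_diff_left inner_diff_right)
  moreover have "w \<bullet> N v = N w \<bullet> v" using pos_semidef_commute[OF assms] by simp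
  moreover have "v \<bullet> N w = N w \<bullet> v" by (rule inner_commute)
  ultimately show ?thesis by linarith
qed

lemma quadratic_form_diff_le:
  assumes "pos_semidef N"
  shows "(v - w) \<bullet> N (v - w) \<le> 2 * (v \<bullet> N v) + 2 * (w \<bullet> N w)"
proof -
  have "0 \<le> (v - - w) \<bullet> N (v - - w)" by (rule pos_semidef_nonneg[OF assms])
  also have "\<dots> = v \<bullet> N v + 2 * (N w \<bullet> v) + w \<bullet> N w"
    unfolding quadratic_form_diff[OF assms] linear_neg[OF pos_semidef_linear[OF assms]] by simp
  finally show ?thesis unfolding quadratic_form_diff[OF assms] by simp
qed

lemma quadratic_form_inner_le:
  assumes "pos_semidef N"
  shows "2 * (N w \<bullet> v) \<le> v \<bullet> N v + w \<bullet> N w"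
  using pos_semidef_nonneg[OF assms, of "v - w"] unfolding quadratic_form_diff[OF assms] by simp

lemma norm_triple_square: "(norm (a, b, e))\<^sup>2 = (norm a)\<^sup>2 + ((norm b)\<^sup>2 + (norm e)\<^sup>2)"
  by (simp add: norm_Pair)

text \<open>On the unit sphere the form attains a positive minimum; homogeneity does the rest.\<close>
lemma quadratic_form_lower_bound:
  fixes N :: "'a::euclidean_space \<Rightarrow> 'a"
  assumes "linear N" and pos: "\<And>v. v \<noteq> 0 \<Longrightarrow> 0 < v \<bullet> N v"
  shows "\<exists>\<mu>>0. \<forall>v. \<mu> * (norm v)\<^sup>2 \<le> v \<bullet> N v"
proof -
  have "continuous_on (sphere 0 1) (\<lambda>v. v \<bullet> N v)"
    using linear_continuous_on[OF assms(1)[unfolded linear_conv_bounded_linear]]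
    by (intro continuous_on_inner continuous_on_id)
  moreover have "sphere (0::'a) 1 \<noteq> {}" by simp
  ultimately obtain w :: 'a where w: "w \<in> sphere 0 1" "\<forall>v\<in>sphere 0 1. w \<bullet> N w \<le> v \<bullet> N v"
    using continuous_attains_inf[OF compact_sphere] by blast
  have "w \<noteq> 0" using w(1) by auto
  then have "0 < w \<bullet> N w" by (rule pos)
  moreover have "w \<bullet> N w * (norm v)\<^sup>2 \<le> v \<bullet> N v" for v
  proof (cases "v = 0")
    case False
    have "w \<bullet> N w \<le> (v /\<^sub>R norm v) \<bullet> N (v /\<^sub>R norm v)" using bspec[OF w(2), of "v /\<^sub>R norm v"] False by simp
    also have "\<dots> = (v \<bullet> N v) / (norm v)\<^sup>2"
      by (simp add: linear_scale[OF assms(1)] power2_eq_square field_simps)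
    finally show ?thesis using False by (simp add: field_simps)
  qed (simp add: linear_0[OF assms(1)])
  ultimately show ?thesis by blast
qed

lemma quadratic_form_upper_bound:
  fixes N :: "'a::euclidean_space \<Rightarrow> 'a"
  assumes "linear N"
  shows "\<exists>C>0. \<forall>v. v \<bullet> N v \<le> C * (norm v)\<^sup>2"
proof -
  obtain C where C: "C > 0" "\<And>v. norm (N v) \<le> C * norm v" using linear_bounded_pos[OF assms] by blast
  have "v \<bullet> N v \<le> C * (norm v)\<^sup>2" for v
  proof -
    have "v \<bullet> N v \<le> norm v * norm (N v)" by (rule norm_cauchy_schwarz)
    also have "\<dots> \<le> norm v * (C * norm v)" using C(2) by (rule mult_left_mono) simp
    finally show ?thesis by (simp add: power2_eq_square mult_ac)
  qed
  then show ?thesis using C(1) by blast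
qed

section \<open>The method and its optimality conditions\<close>

lemma GDERIV_proximal_block:
  fixes A :: "'x::euclidean_space \<Rightarrow> 'y::euclidean_space"
  assumes g: "cont_diff_convex g" and A: "linear A" and S: "pos_semidef S"
  shows "GDERIV (\<lambda>v. g v + x \<bullet> (adjoint A v + b) + \<sigma> / 2 * (norm (adjoint A v + b))\<^sup>2
                   + 1/2 * (op_norm S (v - v0))\<^sup>2) v
         :> grad g v + A (x + \<sigma> *\<^sub>R (adjoint A v + b)) + S (v - v0)"
proof -
  have g': "(g has_derivative (\<lambda>k. k \<bullet> grad g v)) (at v)"
    using cont_diff_convex_GDERIV[OF g] by (simp add: gderiv_def)
  have L: "((\<lambda>v. adjoint A v + b) has_derivative adjoint A) (at v)"
    using has_derivative_add[OF linear_imp_has_derivative[OF adjoint_linear[OF A]] has_derivative_const] by simp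
  have I: "((\<lambda>v. v - v0) has_derivative (\<lambda>k. k)) (at v)" by (auto intro!: derivative_eq_intros)
  have "((\<lambda>v. S (v - v0)) has_derivative (\<lambda>k. S k)) (at v)"
    using has_derivative_compose[OF I linear_imp_has_derivative[OF pos_semidef_linear[OF S]]] .
  note P = has_derivative_mult_right[OF has_derivative_inner[OF I this], of "1/2"]
  note Q = has_derivative_mult_right[OF has_derivative_inner[OF L L], of "\<sigma>/2"]
  note R = has_derivative_inner_right[OF L, of x]
  note D = has_derivative_add[OF has_derivative_add[OF has_derivative_add[OF g' R] Q] P]
  have S': "v \<bullet> S w = w \<bullet> S v" for v w
    using pos_semidef_commute[OF S, of v w] by (simp add: inner_commute)
  show ?thesis
    unfolding gderiv_def op_norm_square[OF S] power2_norm_eq_inner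
  proof (rule has_derivative_eq_rhs[OF D], rule ext)
    fix k
    have "x \<bullet> adjoint A k = k \<bullet> A x" for x
      using adjoint_works[OF A] by (simp add: inner_commute)
    then show "k \<bullet> grad g v + x \<bullet> adjoint A k
        + \<sigma> / 2 * ((adjoint A v + b) \<bullet> adjoint A k + adjoint A k \<bullet> (adjoint A v + b))
        + 1 / 2 * ((v - v0) \<bullet> S k + k \<bullet> S (v - v0)) =
        k \<bullet> (grad g v + A (x + \<sigma> *\<^sub>R (adjoint A v + b)) + S (v - v0))"
      using S'[of "v - v0" k]
      by (simp add: inner_commute[of "adjoint A k"] inner_add_right linear_add[OF A] linear_scale[OF A]
          del: inner_add_left)
  qed
qed

text \<open>Both subproblems of the method have this shape: \<open>K\<close> is the value of the block that is kept fixed and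
  \<open>b\<close> its contribution to the constraint.\<close>
lemma proximal_block_optimality:
  fixes A :: "'x::euclidean_space \<Rightarrow> 'y::euclidean_space"
  assumes f: "proper_closed_convex f" and g: "cont_diff_convex g" and A: "linear A" and S: "pos_semidef S"
    and min: "\<And>w. plus_smooth f g v + ereal K + ereal (x \<bullet> (adjoint A v + b))
                + ereal (\<sigma> / 2 * (norm (adjoint A v + b))\<^sup>2) + ereal (1/2 * (op_norm S (v - v0))\<^sup>2)
              \<le> plus_smooth f g w + ereal K + ereal (x \<bullet> (adjoint A w + b))
                + ereal (\<sigma> / 2 * (norm (adjoint A w + b))\<^sup>2) + ereal (1/2 * (op_norm S (w - v0))\<^sup>2)"
  shows "- (grad g v + A (x + \<sigma> *\<^sub>R (adjoint A v + b)) + S (v - v0)) \<in> subdiff f v"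
proof (rule minimizer_imp_subgradient[OF f _ GDERIV_proximal_block[OF g A S]])
  fix w
  show "f v + ereal (g v + x \<bullet> (adjoint A v + b) + \<sigma> / 2 * (norm (adjoint A v + b))\<^sup>2
                   + 1/2 * (op_norm S (v - v0))\<^sup>2)
     \<le> f w + ereal (g w + x \<bullet> (adjoint A w + b) + \<sigma> / 2 * (norm (adjoint A w + b))\<^sup>2
                   + 1/2 * (op_norm S (w - v0))\<^sup>2)"
    using min[of w] by (cases "f v"; cases "f w") (simp_all add: plus_smooth_def)
qed

text \<open>The subgradients of the composite function that occur below arise as \<open>\<xi>\<close>, where the subgradient of \<open>f\<close> alone
  is \<open>- grad g v + \<xi>\<close>; this is the form in which the optimality conditions provide them.\<close>
lemma monotone_modulus_composite:
  assumes f: "proper_closed_convex f" and g: "cont_diff_convex g"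
    and mono: "monotone_modulus (plus_smooth f g) \<Sigma>"
    and "- (grad g v) + \<xi> \<in> subdiff f v" "- (grad g v') + \<xi>' \<in> subdiff f v'"
  shows "(v' - v) \<bullet> \<Sigma> (v' - v) \<le> (\<xi>' - \<xi>) \<bullet> (v' - v)"
proof -
  have "pos_semidef \<Sigma>" using mono by (simp add: monotone_modulus_def)
  have "\<xi> \<in> subdiff (plus_smooth f g) v" "\<xi>' \<in> subdiff (plus_smooth f g) v'"
    using subdiff_plus_smooth[OF f g assms(4)] subdiff_plus_smooth[OF f g assms(5)] by simp_all
  then have "(\<xi>' - \<xi>) \<bullet> (v' - v) \<ge> (op_norm \<Sigma> (v' - v))\<^sup>2"
    using mono unfolding monotone_modulus_def by blast
  then show ?thesis by (simp add: op_norm_square[OF \<open>pos_semidef \<Sigma>\<close>])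
qed

locale semi_proximal_ADMM =
  fixes \<theta> :: "'y::euclidean_space \<Rightarrow> ereal" and g :: "'y \<Rightarrow> real"
    and \<phi> :: "'z::euclidean_space \<Rightarrow> ereal" and h :: "'z \<Rightarrow> real"
    and A :: "'x::euclidean_space \<Rightarrow> 'y" and B :: "'x \<Rightarrow> 'z" and c :: 'x
    and \<sigma> \<tau> :: real
    and S \<Sigma>\<theta> :: "'y \<Rightarrow> 'y" and T \<Sigma>\<phi> :: "'z \<Rightarrow> 'z"
    and y :: "nat \<Rightarrow> 'y" and z :: "nat \<Rightarrow> 'z" and x :: "nat \<Rightarrow> 'x"
  assumes \<theta>: "proper_closed_convex \<theta>" and \<phi>: "proper_closed_convex \<phi>"
    and g: "cont_diff_convex g" and h: "cont_diff_convex h"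
    and A: "linear A" and B: "linear B"
    and \<sigma>: "\<sigma> > 0"
    and \<tau>: "\<tau> \<in> {0<..<(1 + sqrt 5) / 2}"
    and S: "pos_semidef S" and T: "pos_semidef T"
    and mono_\<theta>: "monotone_modulus (plus_smooth \<theta> g) \<Sigma>\<theta>"
    and mono_\<phi>: "monotone_modulus (plus_smooth \<phi> h) \<Sigma>\<phi>"
    and pos_y: "pos_def (\<lambda>v. \<Sigma>\<theta> v + S v + \<sigma> *\<^sub>R A (adjoint A v))"
    and pos_z: "pos_def (\<lambda>w. \<Sigma>\<phi> w + T w + \<sigma> *\<^sub>R B (adjoint B w))"
    and iter: "sPADMM_sequence \<theta> g \<phi> h A B c \<sigma> \<tau> S T y z x"
begin

definition \<Omega> where "\<Omega> = KKT_set \<theta> g \<phi> h A B c"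
definition R where "R = KKT_map \<theta> g \<phi> h A B c"
definition M where "M = M_op A B \<sigma> \<tau> S T \<Sigma>\<theta> \<Sigma>\<phi>"
definition u where "u k = (y k, z k, x k)"
definition r where "r k = adjoint A (y k) + adjoint B (z k) - c"

lemma \<Sigma>\<theta>: "pos_semidef \<Sigma>\<theta>" and \<Sigma>\<phi>: "pos_semidef \<Sigma>\<phi>"
  using mono_\<theta> mono_\<phi> by (simp_all add: monotone_modulus_def)

lemma \<tau>_pos: "\<tau> > 0" using \<tau> by simp

lemma adj_A: "linear (adjoint A)" and adj_B: "linear (adjoint B)"
  using A B adjoint_linear by blast+

lemma y_minimizes:
  "aug_lagrangian \<theta> g \<phi> h A B c \<sigma> (y (Suc k)) (z k) (x k) + ereal (1/2 * (op_norm S (y (Suc k) - y k))\<^sup>2)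
   \<le> aug_lagrangian \<theta> g \<phi> h A B c \<sigma> v (z k) (x k) + ereal (1/2 * (op_norm S (v - y k))\<^sup>2)"
  using iter unfolding sPADMM_sequence_def argmins_def is_arg_min_linorder by blast

lemma z_minimizes:
  "aug_lagrangian \<theta> g \<phi> h A B c \<sigma> (y (Suc k)) (z (Suc k)) (x k) + ereal (1/2 * (op_norm T (z (Suc k) - z k))\<^sup>2)
   \<le> aug_lagrangian \<theta> g \<phi> h A B c \<sigma> (y (Suc k)) w (x k) + ereal (1/2 * (op_norm T (w - z k))\<^sup>2)"
  using iter unfolding sPADMM_sequence_def argmins_def is_arg_min_linorder by blast

lemma x_step: "x (Suc k) = x k + (\<tau> * \<sigma>) *\<^sub>R r (Suc k)"
  using iter unfolding sPADMM_sequence_def r_def by blast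

lemma y_step_finite:
  assumes "\<phi> (z k) \<noteq> \<infinity>"
  shows "\<theta> (y (Suc k)) \<noteq> \<infinity>"
proof
  assume inf: "\<theta> (y (Suc k)) = \<infinity>"
  obtain b where b: "\<phi> (z k) = ereal b" using proper_closed_convex_finite[OF \<phi> assms] .
  obtain v a where "\<theta> v = ereal a" using proper_point[OF \<theta>] .
  then show False using y_minimizes[of k v] by (simp add: aug_lagrangian_def plus_smooth_def inf b)
qed

text \<open>The augmented Lagrangian of one block is informative only if the other block has a finite value; since
  the iteration starts in the effective domains, this property propagates.\<close>
lemma z_finite: "\<phi> (z k) \<noteq> \<infinity>"
proof (induction k)
  case 0
  show ?case using iter by (simp add: sPADMM_sequence_def eff_dom_def)
next
  case (Suc k)
  show ?case
  proof
    assume inf: "\<phi> (z (Suc k)) = \<infinity>"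
    obtain a where a: "\<theta> (y (Suc k)) = ereal a"
      using proper_closed_convex_finite[OF \<theta> y_step_finite[OF Suc]] .
    obtain w b where "\<phi> w = ereal b" using proper_point[OF \<phi>] .
    then show False using z_minimizes[of k w] by (simp add: aug_lagrangian_def plus_smooth_def inf a)
  qed
qed

text \<open>The \<open>y\<close>-subproblem sees the old \<open>z\<close>, so its infeasibility is the new \<open>r\<close> corrected by \<open>B\<^sup>*\<Delta>z\<close>. This
  correction is the source of the cross term in the energy estimate.\<close>
lemma y_optimality:
  "- (grad g (y (Suc k))) - A (x k + \<sigma> *\<^sub>R (r (Suc k) - adjoint B (z (Suc k) - z k)))
     - S (y (Suc k) - y k) \<in> subdiff \<theta> (y (Suc k))"
proof -
  obtain b where b: "\<phi> (z k) = ereal b" using proper_closed_convex_finite[OF \<phi> z_finite] .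
  have "- (grad g (y (Suc k)) + A (x k + \<sigma> *\<^sub>R (adjoint A (y (Suc k)) + (adjoint B (z k) - c)))
          + S (y (Suc k) - y k)) \<in> subdiff \<theta> (y (Suc k))"
    using y_minimizes[of k]
    by (intro proximal_block_optimality[where K = "b + h (z k)", OF \<theta> g A S])
      (simp add: aug_lagrangian_def plus_smooth_def b add_diff_eq)
  moreover have eq: "adjoint A (y (Suc k)) + (adjoint B (z k) - c) = r (Suc k) - adjoint B (z (Suc k) - z k)"
    by (simp add: r_def linear_diff[OF adj_B])
  ultimately show ?thesis unfolding eq by (simp only: minus_add_distrib diff_conv_add_uminus)
qed

lemma z_optimality:
  "- (grad h (z (Suc k))) - B (x k + \<sigma> *\<^sub>R r (Suc k)) - T (z (Suc k) - z k) \<in> subdiff \<phi> (z (Suc k))"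
proof -
  obtain a where a: "\<theta> (y (Suc k)) = ereal a"
    using proper_closed_convex_finite[OF \<theta> y_step_finite[OF z_finite]] .
  have aug: "aug_lagrangian \<theta> g \<phi> h A B c \<sigma> (y (Suc k)) w (x k) =
      plus_smooth \<phi> h w + ereal (a + g (y (Suc k)))
      + ereal (x k \<bullet> (adjoint B w + (adjoint A (y (Suc k)) - c)))
      + ereal (\<sigma> / 2 * (norm (adjoint B w + (adjoint A (y (Suc k)) - c)))\<^sup>2)" for w
  proof -
    have eq: "adjoint A (y (Suc k)) + adjoint B w - c = adjoint B w + (adjoint A (y (Suc k)) - c)" by simp
    show ?thesis unfolding aug_lagrangian_def eq
      by (simp only: plus_smooth_def a plus_ereal.simps add.commute[of "ereal (a + g (y (Suc k)))"])
  qed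
  have "- (grad h (z (Suc k)) + B (x k + \<sigma> *\<^sub>R (adjoint B (z (Suc k)) + (adjoint A (y (Suc k)) - c)))
          + T (z (Suc k) - z k)) \<in> subdiff \<phi> (z (Suc k))"
    using z_minimizes[of k] unfolding aug
    by (intro proximal_block_optimality[OF \<phi> h B T])
  moreover have eq: "adjoint B (z (Suc k)) + (adjoint A (y (Suc k)) - c) = r (Suc k)"
    by (simp add: r_def)
  ultimately show ?thesis unfolding eq by (simp only: minus_add_distrib diff_conv_add_uminus)
qed

lemma KKT_iff:
  "(ys, zs, xs) \<in> \<Omega> \<longleftrightarrow>
     - (grad g ys) - A xs \<in> subdiff \<theta> ys \<and> - (grad h zs) - B xs \<in> subdiff \<phi> zs \<and>
     adjoint A ys + adjoint B zs = c"
proof -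
  have img: "0 \<in> (\<lambda>\<xi>. \<xi> + p + q) ` X \<longleftrightarrow> - p - q \<in> X" for p q and X :: "'b::euclidean_space set"
  proof -
    have "0 = \<xi> + p + q \<longleftrightarrow> \<xi> = - p - q" for \<xi> by (auto simp: algebra_simps eq_neg_iff_add_eq_0)
    then show ?thesis by (simp add: image_iff)
  qed
  have "c - adjoint A ys - adjoint B zs = 0 \<longleftrightarrow> adjoint A ys + adjoint B zs = c"
    by (auto simp: algebra_simps)
  then show ?thesis by (simp add: \<Omega>_def KKT_set_def img)
qed

lemmas monotone_\<theta>g = monotone_modulus_composite[OF \<theta> g mono_\<theta>]
lemmas monotone_\<phi>h = monotone_modulus_composite[OF \<phi> h mono_\<phi>]

end

section \<open>Descent of the energy\<close>

text \<open>The inner products produced by the two optimality conditions, with \<open>w\<close> the old multiplier error,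
  \<open>p + q\<close> the new infeasibility and \<open>d = B\<^sup>*\<Delta>z\<close>, rewritten as differences of squares that telescope along the
  iteration, multiples of the squares of \<open>p + q\<close> and \<open>d\<close>, and the cross term \<open>\<langle>d, p + q\<rangle>\<close>.\<close>
lemma multiplier_step_identity:
  fixes w p q d :: "'a::real_inner"
  assumes "\<tau> > 0" and "\<sigma> > 0"
  shows "2 * (- ((w + \<sigma> *\<^sub>R (p + q - d)) \<bullet> p) - (w + \<sigma> *\<^sub>R (p + q)) \<bullet> q) =
    ((norm w)\<^sup>2 - (norm (w + (\<tau> * \<sigma>) *\<^sub>R (p + q)))\<^sup>2) / (\<tau> * \<sigma>)
    - (2 - \<tau>) * \<sigma> * (norm (p + q))\<^sup>2 + 2 * \<sigma> * (d \<bullet> (p + q))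
    + \<sigma> * ((norm (q - d))\<^sup>2 - (norm q)\<^sup>2 - (norm d)\<^sup>2)"
proof -
  define s where "s = p + q"
  have "(norm w)\<^sup>2 - (norm (w + (\<tau> * \<sigma>) *\<^sub>R s))\<^sup>2 = - (2 * (\<tau> * \<sigma>) * (w \<bullet> s)) - (\<tau> * \<sigma>)\<^sup>2 * (norm s)\<^sup>2"
    unfolding power2_norm_eq_inner inner_add_left inner_add_right inner_scaleR_left inner_scaleR_right
    by (simp add: inner_commute[of s w] power2_eq_square algebra_simps)
  then have 1: "((norm w)\<^sup>2 - (norm (w + (\<tau> * \<sigma>) *\<^sub>R s))\<^sup>2) / (\<tau> * \<sigma>) = - 2 * (w \<bullet> s) - \<tau> * \<sigma> * (norm s)\<^sup>2"
    using assms by (simp add: field_simps power2_eq_square)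
  have 2: "(norm (q - d))\<^sup>2 - (norm q)\<^sup>2 - (norm d)\<^sup>2 = - 2 * (d \<bullet> q)"
    unfolding power2_norm_eq_inner by (simp add: inner_diff_left inner_diff_right inner_commute[of q d])
  have 3: "(w + \<sigma> *\<^sub>R (s - d)) \<bullet> p + (w + \<sigma> *\<^sub>R s) \<bullet> q = w \<bullet> s + \<sigma> * (norm s)\<^sup>2 - \<sigma> * (d \<bullet> p)"
    unfolding power2_norm_eq_inner
    by (simp add: s_def inner_add_left inner_add_right inner_diff_left algebra_simps)
  have 4: "d \<bullet> p = d \<bullet> s - d \<bullet> q" by (simp add: s_def inner_add_right)
  have "2 * (- ((w + \<sigma> *\<^sub>R (s - d)) \<bullet> p) - (w + \<sigma> *\<^sub>R s) \<bullet> q)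
      = - 2 * (w \<bullet> s) - 2 * \<sigma> * (norm s)\<^sup>2 + 2 * \<sigma> * (d \<bullet> p)"
    using 3 by (simp add: algebra_simps)
  also have "\<dots> = - 2 * (w \<bullet> s) - \<tau> * \<sigma> * (norm s)\<^sup>2 - (2 - \<tau>) * \<sigma> * (norm s)\<^sup>2
      + 2 * \<sigma> * (d \<bullet> s) + \<sigma> * (- 2 * (d \<bullet> q))"
    unfolding 4 by (simp add: algebra_simps)
  finally show ?thesis unfolding s_def[symmetric] 1 2 .
qed

text \<open>The two coefficients on the right have product \<open>(1 - \<tau>)\<^sup>2\<close>. For \<open>\<tau> \<le> 1\<close> both equal \<open>1 - \<tau>\<close>; for
  \<open>\<tau> > 1\<close> they are \<open>(\<tau> - 1) / \<tau>\<close> and \<open>(\<tau> - 1) \<tau>\<close>. The first becomes part of the energy, and the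
  second leaves a positive share of \<open>\<parallel>B\<^sup>*\<Delta>z\<parallel>\<^sup>2\<close> as long as \<open>1 - \<tau> + min \<tau> (1 / \<tau>) > 0\<close>.\<close>
lemma relaxation_young:
  fixes v w :: "'a::real_inner"
  assumes "\<tau> > 0"
  shows "2 * (1 - \<tau>) * (v \<bullet> w) \<le> (1 - min \<tau> (inverse \<tau>)) * (norm v)\<^sup>2
    + (1 - \<tau> * (1 - \<tau> + min \<tau> (inverse \<tau>))) * (norm w)\<^sup>2"
proof (cases "\<tau> \<le> 1")
  case True
  then have m: "min \<tau> (inverse \<tau>) = \<tau>" using assms by (simp add: min_def field_simps mult_le_one)
  have "0 \<le> (1 - \<tau>) * (norm (v - w))\<^sup>2" using True by simp
  also have "(norm (v - w))\<^sup>2 = (norm v)\<^sup>2 + (norm w)\<^sup>2 - 2 * (v \<bullet> w)"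
    by (simp add: power2_norm_eq_inner inner_diff_left inner_diff_right inner_commute[of w v])
  finally show ?thesis unfolding m by (simp add: algebra_simps)
next
  case False
  then have m: "min \<tau> (inverse \<tau>) = inverse \<tau>"
    using assms less_1_mult[of \<tau> \<tau>] by (simp add: min_def field_simps)
  have "0 \<le> (\<tau> - 1) / \<tau> * (norm (v + \<tau> *\<^sub>R w))\<^sup>2" using False by simp
  also have "(norm (v + \<tau> *\<^sub>R w))\<^sup>2 = (norm v)\<^sup>2 + \<tau>\<^sup>2 * (norm w)\<^sup>2 + 2 * \<tau> * (v \<bullet> w)"
    unfolding power2_norm_eq_inner
    by (simp add: inner_add_left inner_add_right inner_commute[of w v] power2_eq_square algebra_simps)
  also have "(\<tau> - 1) / \<tau> * ((norm v)\<^sup>2 + \<tau>\<^sup>2 * (norm w)\<^sup>2 + 2 * \<tau> * (v \<bullet> w))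
      = (1 - inverse \<tau>) * (norm v)\<^sup>2 + (1 - \<tau> * (1 - \<tau> + inverse \<tau>)) * (norm w)\<^sup>2
        - 2 * (1 - \<tau>) * (v \<bullet> w)"
    using assms by (simp add: field_simps power2_eq_square)
  finally show ?thesis unfolding m by simp
qed

context semi_proximal_ADMM
begin

text \<open>The classical energy of the method relative to a KKT point. It is the part of the squared \<open>M\<close>-distance
  that contains neither the moduli \<open>\<Sigma>\<theta>\<close>, \<open>\<Sigma>\<phi>\<close> nor the infeasibility.\<close>
definition \<Phi> where
  "\<Phi> ys zs xs k = (norm (x k - xs))\<^sup>2 / (\<tau> * \<sigma>) + (y k - ys) \<bullet> S (y k - ys) + (z k - zs) \<bullet> T (z k - zs)
     + \<sigma> * (norm (adjoint B (z k - zs)))\<^sup>2"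

definition \<Delta>y where "\<Delta>y k = y (Suc k) - y k"
definition \<Delta>z where "\<Delta>z k = z (Suc k) - z k"

text \<open>The sum of the two monotonicity inequalities between the new iterate and the KKT point. The quadratic forms
  of \<open>S\<close> and \<open>T\<close> telescope by the three-point identity, the multiplier terms by
  \<open>multiplier_step_identity\<close>.\<close>
lemma \<Phi>_step:
  assumes "(ys, zs, xs) \<in> \<Omega>"
  shows "(2 - \<tau>) * \<sigma> * (norm (r (Suc k)))\<^sup>2 - 2 * \<sigma> * (adjoint B (\<Delta>z k) \<bullet> r (Suc k))
      + \<sigma> * (norm (adjoint B (\<Delta>z k)))\<^sup>2 + \<Delta>y k \<bullet> S (\<Delta>y k) + \<Delta>z k \<bullet> T (\<Delta>z k)
      + 2 * ((y (Suc k) - ys) \<bullet> \<Sigma>\<theta> (y (Suc k) - ys)) + 2 * ((z (Suc k) - zs) \<bullet> \<Sigma>\<phi> (z (Suc k) - zs))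
    \<le> \<Phi> ys zs xs k - \<Phi> ys zs xs (Suc k)"
proof -
  define a where "a = y (Suc k) - ys"
  define b where "b = z (Suc k) - zs"
  define w where "w = x k - xs"
  define p where "p = adjoint A a"
  define q where "q = adjoint B b"
  define d where "d = adjoint B (\<Delta>z k)"
  note KKT = assms[unfolded KKT_iff]
  have rpq: "r (Suc k) = p + q"
    using KKT by (simp add: r_def p_def q_def a_def b_def linear_diff[OF adj_A] linear_diff[OF adj_B] algebra_simps)
  have A': "A v \<bullet> a = v \<bullet> p" for v using adjoint_works[OF A, of v a] by (simp add: p_def)
  have B': "B v \<bullet> b = v \<bullet> q" for v using adjoint_works[OF B, of v b] by (simp add: q_def)
  have "(- A (x k + \<sigma> *\<^sub>R (p + q - d)) - S (\<Delta>y k) - (- A xs)) \<bullet> a \<ge> a \<bullet> \<Sigma>\<theta> a"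
    using y_optimality[of k] KKT unfolding a_def rpq[symmetric] d_def \<Delta>y_def \<Delta>z_def
    by (intro monotone_\<theta>g) (simp_all only: diff_conv_add_uminus add.assoc)
  then have 1: "a \<bullet> \<Sigma>\<theta> a \<le> - ((w + \<sigma> *\<^sub>R (p + q - d)) \<bullet> p) - S (\<Delta>y k) \<bullet> a"
    by (simp add: inner_diff_left A' w_def inner_add_left)
  have "(- B (x k + \<sigma> *\<^sub>R (p + q)) - T (\<Delta>z k) - (- B xs)) \<bullet> b \<ge> b \<bullet> \<Sigma>\<phi> b"
    using z_optimality[of k] KKT unfolding b_def rpq[symmetric] \<Delta>z_def
    by (intro monotone_\<phi>h) (simp_all only: diff_conv_add_uminus add.assoc)
  then have 2: "b \<bullet> \<Sigma>\<phi> b \<le> - ((w + \<sigma> *\<^sub>R (p + q)) \<bullet> q) - T (\<Delta>z k) \<bullet> b"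
    by (simp add: inner_diff_left B' w_def inner_add_left)
  have ya: "y k - ys = a - \<Delta>y k" and zb: "z k - zs = b - \<Delta>z k"
    by (simp_all add: a_def b_def \<Delta>y_def \<Delta>z_def)
  have 3: "(y k - ys) \<bullet> S (y k - ys) = a \<bullet> S a - 2 * (S (\<Delta>y k) \<bullet> a) + \<Delta>y k \<bullet> S (\<Delta>y k)"
    unfolding ya by (rule quadratic_form_diff[OF S])
  have 4: "(z k - zs) \<bullet> T (z k - zs) = b \<bullet> T b - 2 * (T (\<Delta>z k) \<bullet> b) + \<Delta>z k \<bullet> T (\<Delta>z k)"
    unfolding zb by (rule quadratic_form_diff[OF T])
  have 5: "adjoint B (z k - zs) = q - d" unfolding zb by (simp add: linear_diff[OF adj_B] q_def d_def)
  have 6: "x (Suc k) - xs = w + (\<tau> * \<sigma>) *\<^sub>R (p + q)" by (simp add: x_step w_def rpq)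
  have "\<Phi> ys zs xs k - \<Phi> ys zs xs (Suc k)
      = ((norm w)\<^sup>2 - (norm (w + (\<tau> * \<sigma>) *\<^sub>R (p + q)))\<^sup>2) / (\<tau> * \<sigma>)
        + \<sigma> * ((norm (q - d))\<^sup>2 - (norm q)\<^sup>2)
        - 2 * (S (\<Delta>y k) \<bullet> a) + \<Delta>y k \<bullet> S (\<Delta>y k) - 2 * (T (\<Delta>z k) \<bullet> b) + \<Delta>z k \<bullet> T (\<Delta>z k)"
    unfolding \<Phi>_def 3 4 5 6 w_def[symmetric] a_def[symmetric] b_def[symmetric] q_def[symmetric]
    by (simp add: diff_divide_distrib algebra_simps)
  with 1 2 multiplier_step_identity[OF \<tau>_pos \<sigma>, of w p q d]
  show ?thesis unfolding rpq a_def[symmetric] b_def[symmetric] d_def[symmetric]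
    by (simp add: algebra_simps)
qed

text \<open>Monotonicity between the optimality conditions of two consecutive \<open>z\<close>-subproblems. The multiplier update
  leaves only the fraction \<open>1 - \<tau>\<close> of the previous infeasibility, and the term \<open>\<langle>T\<Delta>z, \<Delta>z'\<rangle>\<close> for consecutive steps \<open>\<Delta>z\<close>, \<open>\<Delta>z'\<close> is split
  evenly. This is why the \<open>T\<close>-length of \<open>\<Delta>z\<close> enters the energy and why the estimate needs one
  completed iteration before it applies.\<close>
lemma consecutive_z_steps:
  "\<Delta>z (Suc k) \<bullet> T (\<Delta>z (Suc k)) - \<Delta>z k \<bullet> T (\<Delta>z k) - 2 * (1 - \<tau>) * \<sigma> * (r (Suc k) \<bullet> adjoint B (\<Delta>z (Suc k)))
   \<le> - 2 * \<sigma> * (adjoint B (\<Delta>z (Suc k)) \<bullet> r (Suc (Suc k)))"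
proof -
  define e where "e = \<Delta>z (Suc k)"
  define d where "d = adjoint B e"
  have B': "B v \<bullet> e = v \<bullet> d" for v using adjoint_works[OF B, of v e] by (simp add: d_def)
  have "(- B (x (Suc k) + \<sigma> *\<^sub>R r (Suc (Suc k))) - T e - (- B (x k + \<sigma> *\<^sub>R r (Suc k)) - T (\<Delta>z k))) \<bullet> e
      \<ge> e \<bullet> \<Sigma>\<phi> e"
    using z_optimality[of k] z_optimality[of "Suc k"] unfolding e_def \<Delta>z_def
    by (intro monotone_\<phi>h) (simp_all only: diff_conv_add_uminus add.assoc)
  moreover have "e \<bullet> \<Sigma>\<phi> e \<ge> 0" by (rule pos_semidef_nonneg[OF \<Sigma>\<phi>])
  ultimately have "(x (Suc k) + \<sigma> *\<^sub>R r (Suc (Suc k)) - x k - \<sigma> *\<^sub>R r (Suc k)) \<bullet> d + T e \<bullet> e - T (\<Delta>z k) \<bullet> e \<le> 0"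
    by (simp add: inner_diff_left B' inner_add_left)
  then have "\<sigma> * (d \<bullet> r (Suc (Suc k))) - (1 - \<tau>) * \<sigma> * (r (Suc k) \<bullet> d) + T e \<bullet> e - T (\<Delta>z k) \<bullet> e \<le> 0"
    by (simp add: x_step inner_diff_left inner_add_left inner_commute[of d] algebra_simps)
  moreover have "T e \<bullet> e = e \<bullet> T e" by (rule inner_commute)
  ultimately show ?thesis
    using quadratic_form_inner_le[OF T, of "\<Delta>z k" e]
    unfolding e_def[symmetric] d_def[symmetric] by (simp add: algebra_simps)
qed

definition m where "m = min \<tau> (inverse \<tau>)"

text \<open>The golden ratio enters here: it is the positive root of \<open>\<tau>\<^sup>2 = \<tau> + 1\<close>.\<close>
lemma step_length_bounds: "0 < 1 - \<tau> + m" "m \<le> 1"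
proof -
  have gold: "\<tau> * \<tau> < \<tau> + 1"
  proof -
    have "2 * \<tau> - 1 < sqrt 5" using \<tau> by simp
    then have "(2 * \<tau> - 1) * (2 * \<tau> - 1) < 5"
    proof (cases "2 * \<tau> - 1 \<ge> 0")
      case True
      then have "(2 * \<tau> - 1) * (2 * \<tau> - 1) < sqrt 5 * sqrt 5"
        using \<open>2 * \<tau> - 1 < sqrt 5\<close> by (intro mult_strict_mono) auto
      then show ?thesis by simp
    next
      case False
      then have "(1 - 2 * \<tau>) * (1 - 2 * \<tau>) \<le> 1 * 1" using \<tau>_pos by (intro mult_mono) auto
      then show ?thesis by (simp add: algebra_simps)
    qed
    then show ?thesis by (simp add: algebra_simps)
  qed
  then have "0 < 1 - \<tau> + inverse \<tau>" using \<tau>_pos by (simp add: field_simps)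
  then show "0 < 1 - \<tau> + m" by (simp add: m_def min_def)
  show "m \<le> 1"
  proof (cases "\<tau> \<le> 1")
    case False
    then have "inverse \<tau> \<le> 1" by (simp add: inverse_le_1_iff)
    then show ?thesis by (simp add: m_def min_le_iff_disj)
  qed (simp add: m_def)
qed

text \<open>The weight of the infeasibility in \<open>M\<close> is \<open>1 - m\<close>, needed to telescope the term from
  \<open>relaxation_young\<close>, plus a quarter of the surplus \<open>1 - \<tau> + m\<close>. The extra quarter makes the infeasibility before
  the step appear in the decrease, which is needed to bound \<open>A\<^sup>*\<Delta>y\<close>.\<close>
lemma s_tau_eq: "s_tau \<tau> = 1 - m + (1 - \<tau> + m) / 4"
  by (simp add: s_tau_def m_def field_simps)

lemma s_tau_pos: "s_tau \<tau> > 0"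
  using step_length_bounds unfolding s_tau_eq by (intro add_nonneg_pos) simp_all

section \<open>The quadratic form of the distance\<close>

lemma linear_E_adj: "linear (E_adj A B)"
  by (rule linearI)
    (auto simp: E_adj_def linear_add[OF adj_A] linear_add[OF adj_B] linear_scale[OF adj_A]
      linear_scale[OF adj_B] algebra_simps)

lemma M_form:
  "(a, b, e) \<bullet> M (a, b, e) = a \<bullet> S a + a \<bullet> \<Sigma>\<theta> a + b \<bullet> T b + b \<bullet> \<Sigma>\<phi> b + \<sigma> * (norm (adjoint B b))\<^sup>2
    + (norm e)\<^sup>2 / (\<tau> * \<sigma>) + s_tau \<tau> * \<sigma> * (norm (adjoint A a + adjoint B b))\<^sup>2"
proof -
  have E: "v \<bullet> E_op A B (E_adj A B v) = (norm (E_adj A B v))\<^sup>2" for v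
    using adjoint_works[OF linear_E_adj, of v "E_adj A B v"] by (simp add: E_op_def power2_norm_eq_inner)
  have Bb: "b \<bullet> B (adjoint B b) = (norm (adjoint B b))\<^sup>2"
    using adjoint_works[OF B, of "adjoint B b" b] by (simp add: power2_norm_eq_inner inner_commute)
  have "(a, b, e) \<bullet> M (a, b, e) = a \<bullet> (S a + \<Sigma>\<theta> a) + (b \<bullet> (T b + \<Sigma>\<phi> b + \<sigma> *\<^sub>R B (adjoint B b))
      + e \<bullet> (inverse (\<tau> * \<sigma>) *\<^sub>R e)) + (s_tau \<tau> * \<sigma>) * (norm (E_adj A B (a, b, e)))\<^sup>2"
    unfolding M_def M_op_def prod.case inner_add_right[of "(a, b, e)"] inner_scaleR_right[of "(a, b, e)"] E
    by (simp only: inner_Pair)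
  then show ?thesis
    by (simp add: inner_add_right Bb E_adj_def power2_norm_eq_inner[of e] divide_inverse)
qed

lemma linear_M: "linear M"
proof -
  have E: "linear (E_op A B)" unfolding E_op_def using linear_E_adj by (rule adjoint_linear)
  note lin = pos_semidef_linear[OF S] pos_semidef_linear[OF T] pos_semidef_linear[OF \<Sigma>\<theta>]
    pos_semidef_linear[OF \<Sigma>\<phi>] B adj_B E linear_E_adj
  have "E_adj A B (a + a', b + b', e + e') = E_adj A B (a, b, e) + E_adj A B (a', b', e')"
    for a a' b b' e e'
    using linear_add[OF linear_E_adj, of "(a, b, e)" "(a', b', e')"] by simp
  moreover have "E_adj A B (t *\<^sub>R a, t *\<^sub>R b, t *\<^sub>R e) = t *\<^sub>R E_adj A B (a, b, e)" for t a b e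
    using linear_scale[OF linear_E_adj, of t "(a, b, e)"] by simp
  ultimately show ?thesis unfolding M_def M_op_def
    by (intro linearI) (auto simp: lin[THEN linear_add] lin[THEN linear_scale] algebra_simps)
qed

lemma pos_y_form: "a \<bullet> (\<Sigma>\<theta> a + S a + \<sigma> *\<^sub>R A (adjoint A a)) = a \<bullet> \<Sigma>\<theta> a + a \<bullet> S a + \<sigma> * (norm (adjoint A a))\<^sup>2"
  using adjoint_works[OF A, of "adjoint A a" a]
  by (simp add: inner_add_right power2_norm_eq_inner inner_commute[of a "A _"])

lemma pos_z_form: "b \<bullet> (\<Sigma>\<phi> b + T b + \<sigma> *\<^sub>R B (adjoint B b)) = b \<bullet> \<Sigma>\<phi> b + b \<bullet> T b + \<sigma> * (norm (adjoint B b))\<^sup>2"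
  using adjoint_works[OF B, of "adjoint B b" b]
  by (simp add: inner_add_right power2_norm_eq_inner inner_commute[of b "B _"])

lemma M_nonneg: "0 \<le> v \<bullet> M v"
proof -
  obtain a b e where v: "v = (a, b, e)" by (cases v)
  show ?thesis unfolding v M_form
    using S T \<Sigma>\<theta> \<Sigma>\<phi> \<sigma> \<tau>_pos s_tau_pos by (simp add: pos_semidef_nonneg)
qed

lemma M_positive:
  assumes "v \<noteq> 0"
  shows "0 < v \<bullet> M v"
proof (rule ccontr)
  assume "\<not> 0 < v \<bullet> M v"
  then have 0: "v \<bullet> M v = 0" using M_nonneg[of v] by linarith
  obtain a b e where v: "v = (a, b, e)" by (cases v)
  have nn: "0 \<le> a \<bullet> S a" "0 \<le> a \<bullet> \<Sigma>\<theta> a" "0 \<le> b \<bullet> T b" "0 \<le> b \<bullet> \<Sigma>\<phi> b" "0 \<le> \<sigma> * (norm (adjoint B b))\<^sup>2"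
    "0 \<le> (norm e)\<^sup>2 / (\<tau> * \<sigma>)" "0 \<le> s_tau \<tau> * \<sigma> * (norm (adjoint A a + adjoint B b))\<^sup>2"
    using S T \<Sigma>\<theta> \<Sigma>\<phi> \<sigma> \<tau>_pos s_tau_pos by (simp_all add: pos_semidef_nonneg)
  have z: "a \<bullet> S a = 0" "a \<bullet> \<Sigma>\<theta> a = 0" "b \<bullet> T b = 0" "b \<bullet> \<Sigma>\<phi> b = 0" "\<sigma> * (norm (adjoint B b))\<^sup>2 = 0"
    "(norm e)\<^sup>2 / (\<tau> * \<sigma>) = 0" "s_tau \<tau> * \<sigma> * (norm (adjoint A a + adjoint B b))\<^sup>2 = 0"
    using nn 0 unfolding v M_form by linarith+
  have "e = 0" using z(6) \<sigma> \<tau>_pos by simp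
  moreover have "b = 0"
    using pos_z pos_z_form[of b] z by (auto simp: pos_def_def)
  moreover have "adjoint A a = 0"
    using z(7) s_tau_pos \<sigma> \<open>b = 0\<close> by (simp add: linear_0[OF adj_B])
  then have "a = 0"
    using pos_y pos_y_form[of a] z by (auto simp: pos_def_def)
  ultimately show False using assms v by (simp add: zero_prod_def)
qed

lemma op_norm_M: "(op_norm M v)\<^sup>2 = v \<bullet> M v"
  by (simp add: op_norm_def M_nonneg)

section \<open>Sufficient descent\<close>

lemma M_distance:
  assumes "(ys, zs, xs) \<in> \<Omega>"
  shows "(u k - (ys, zs, xs)) \<bullet> M (u k - (ys, zs, xs)) = \<Phi> ys zs xs k
    + (y k - ys) \<bullet> \<Sigma>\<theta> (y k - ys) + (z k - zs) \<bullet> \<Sigma>\<phi> (z k - zs) + s_tau \<tau> * \<sigma> * (norm (r k))\<^sup>2"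
proof -
  have "r k = adjoint A (y k - ys) + adjoint B (z k - zs)"
    using assms by (simp add: KKT_iff r_def linear_diff[OF adj_A] linear_diff[OF adj_B] algebra_simps)
  then show ?thesis by (simp add: u_def M_form \<Phi>_def)
qed

text \<open>The energy estimate with all seminorms kept. One of the two copies of each \<open>\<Sigma>\<close>-term in \<open>\<Phi>_step\<close> is paired
  with the \<open>\<Sigma>\<close>-term of the old distance and thereby bounds the \<open>\<Sigma>\<close>-length of the step.\<close>
lemma M_descent:
  assumes us: "(ys, zs, xs) \<in> \<Omega>"
  defines "W \<equiv> \<lambda>k. (u (Suc k) - (ys, zs, xs)) \<bullet> M (u (Suc k) - (ys, zs, xs)) + \<Delta>z k \<bullet> T (\<Delta>z k)"
  shows "(1 - \<tau> + m) / 4 * \<sigma> * ((norm (r (Suc (Suc k))))\<^sup>2 + (norm (r (Suc k)))\<^sup>2)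
      + \<tau> * (1 - \<tau> + m) * \<sigma> * (norm (adjoint B (\<Delta>z (Suc k))))\<^sup>2
      + \<Delta>y (Suc k) \<bullet> S (\<Delta>y (Suc k)) + \<Delta>z (Suc k) \<bullet> T (\<Delta>z (Suc k))
      + 1/2 * (\<Delta>y (Suc k) \<bullet> \<Sigma>\<theta> (\<Delta>y (Suc k))) + 1/2 * (\<Delta>z (Suc k) \<bullet> \<Sigma>\<phi> (\<Delta>z (Suc k)))
    \<le> W k - W (Suc k)"
proof -
  define d where "d = adjoint B (\<Delta>z (Suc k))"
  define r1 where "r1 = r (Suc k)"
  define r2 where "r2 = r (Suc (Suc k))"
  define t where "t = 1 - \<tau> + m"
  have t: "t > 0" unfolding t_def by (rule step_length_bounds)
  have Y: "\<Delta>y (Suc k) \<bullet> \<Sigma>\<theta> (\<Delta>y (Suc k)) \<le> 2 * ((y (Suc (Suc k)) - ys) \<bullet> \<Sigma>\<theta> (y (Suc (Suc k)) - ys))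
      + 2 * ((y (Suc k) - ys) \<bullet> \<Sigma>\<theta> (y (Suc k) - ys))"
    using quadratic_form_diff_le[OF \<Sigma>\<theta>, of "y (Suc (Suc k)) - ys" "y (Suc k) - ys"] by (simp add: \<Delta>y_def)
  have Z: "\<Delta>z (Suc k) \<bullet> \<Sigma>\<phi> (\<Delta>z (Suc k)) \<le> 2 * ((z (Suc (Suc k)) - zs) \<bullet> \<Sigma>\<phi> (z (Suc (Suc k)) - zs))
      + 2 * ((z (Suc k) - zs) \<bullet> \<Sigma>\<phi> (z (Suc k) - zs))"
    using quadratic_form_diff_le[OF \<Sigma>\<phi>, of "z (Suc (Suc k)) - zs" "z (Suc k) - zs"] by (simp add: \<Delta>z_def)
  have "2 * (1 - \<tau>) * (r1 \<bullet> d) \<le> (1 - m) * (norm r1)\<^sup>2 + (1 - \<tau> * t) * (norm d)\<^sup>2"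
    using relaxation_young[OF \<tau>_pos] by (simp add: m_def t_def)
  from mult_left_mono[OF this, of \<sigma>] have young:
    "2 * (1 - \<tau>) * \<sigma> * (r1 \<bullet> d) \<le> (1 - m) * \<sigma> * (norm r1)\<^sup>2 + \<sigma> * (norm d)\<^sup>2 - \<tau> * t * \<sigma> * (norm d)\<^sup>2"
    using \<sigma> by (simp add: algebra_simps)
  have W: "W k = \<Phi> ys zs xs (Suc k) + (y (Suc k) - ys) \<bullet> \<Sigma>\<theta> (y (Suc k) - ys)
      + (z (Suc k) - zs) \<bullet> \<Sigma>\<phi> (z (Suc k) - zs) + (1 - m) * \<sigma> * (norm (r (Suc k)))\<^sup>2
      + t / 4 * \<sigma> * (norm (r (Suc k)))\<^sup>2 + \<Delta>z k \<bullet> T (\<Delta>z k)" for k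
    unfolding W_def M_distance[OF us] s_tau_eq t_def by (simp add: algebra_simps)
  have "(2 - \<tau>) * \<sigma> * (norm r2)\<^sup>2 = (1 - m) * \<sigma> * (norm r2)\<^sup>2 + t * \<sigma> * (norm r2)\<^sup>2"
    by (simp add: t_def algebra_simps)
  moreover have "t * \<sigma> * (norm r2)\<^sup>2 \<ge> t / 2 * \<sigma> * (norm r2)\<^sup>2"
    using t \<sigma> by (intro mult_right_mono) auto
  moreover note \<Phi>_step[OF us, of "Suc k"] consecutive_z_steps[of k]
  ultimately show ?thesis
    using young Y Z unfolding W t_def[symmetric] d_def[symmetric] r1_def[symmetric] r2_def[symmetric]
    by (simp add: algebra_simps)
qed

text \<open>From seminorms to the norm: \<open>A\<^sup>*\<Delta>y\<close> is the difference of two infeasibilities minus \<open>B\<^sup>*\<Delta>z\<close>, and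
  \<open>\<Delta>x\<close> is a multiple of the new infeasibility, so the decrease dominates the two positive definite forms at
  \<open>\<Delta>y\<close> and \<open>\<Delta>z\<close> together with \<open>\<parallel>\<Delta>x\<parallel>\<^sup>2\<close>.\<close>
lemma sufficient_descent:
  "\<exists>\<kappa>>0. \<forall>us\<in>\<Omega>. \<forall>k. \<kappa> * (norm (u (Suc (Suc k)) - u (Suc k)))\<^sup>2
     \<le> ((u (Suc k) - us) \<bullet> M (u (Suc k) - us) + \<Delta>z k \<bullet> T (\<Delta>z k))
       - ((u (Suc (Suc k)) - us) \<bullet> M (u (Suc (Suc k)) - us) + \<Delta>z (Suc k) \<bullet> T (\<Delta>z (Suc k)))"
proof -
  have "linear (\<lambda>v. \<Sigma>\<theta> v + S v + \<sigma> *\<^sub>R A (adjoint A v))" "linear (\<lambda>v. \<Sigma>\<phi> v + T v + \<sigma> *\<^sub>R B (adjoint B v))"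
    using pos_y pos_z by (simp_all add: pos_def_def self_adjoint_def)
  note lin = this
  obtain \<mu>1 where \<mu>1: "\<mu>1 > 0" "\<forall>v. \<mu>1 * (norm v)\<^sup>2 \<le> v \<bullet> \<Sigma>\<theta> v + v \<bullet> S v + \<sigma> * (norm (adjoint A v))\<^sup>2"
    using quadratic_form_lower_bound[OF lin(1)] pos_y unfolding pos_def_def pos_y_form by auto
  obtain \<mu>2 where \<mu>2: "\<mu>2 > 0" "\<forall>v. \<mu>2 * (norm v)\<^sup>2 \<le> v \<bullet> \<Sigma>\<phi> v + v \<bullet> T v + \<sigma> * (norm (adjoint B v))\<^sup>2"
    using quadratic_form_lower_bound[OF lin(2)] pos_z unfolding pos_def_def pos_z_form by auto
  define t where "t = 1 - \<tau> + m"
  have t: "t > 0" unfolding t_def by (rule step_length_bounds)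
  \<comment> \<open>Bounding \<open>A\<^sup>*\<Delta>y\<close> uses each of \<open>r2\<close>, \<open>r1\<close>, \<open>d\<close> three times, and \<open>r2\<close> and \<open>d\<close> occur once more in the
    bounds for \<open>\<Delta>x\<close> and \<open>\<Delta>z\<close>; the minimum makes four copies of each affordable. The bound
    \<open>1/2\<close> is the share of the \<open>\<Sigma>\<close>-terms in the decrease.\<close>
  define \<epsilon> where "\<epsilon> = min (1/2) (min (t / 16) (\<tau> * t / 4))"
  have \<epsilon>: "\<epsilon> > 0" "\<epsilon> \<le> 1/2" "4 * \<epsilon> \<le> t / 4" "4 * \<epsilon> \<le> \<tau> * t"
    using t \<tau>_pos by (auto simp: \<epsilon>_def)
  define \<nu> where "\<nu> = min (min \<mu>1 \<mu>2) (1 / (\<tau>\<^sup>2 * \<sigma>))"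
  have \<nu>: "\<nu> > 0" "\<nu> \<le> \<mu>1" "\<nu> \<le> \<mu>2" "\<nu> \<le> 1 / (\<tau>\<^sup>2 * \<sigma>)"
    using \<mu>1(1) \<mu>2(1) \<tau>_pos \<sigma> by (auto simp: \<nu>_def)
  show ?thesis
  proof (intro exI[of _ "\<epsilon> * \<nu>"] conjI ballI allI)
    show "\<epsilon> * \<nu> > 0" using \<epsilon>(1) \<nu>(1) by simp
    fix us k assume us: "us \<in> \<Omega>"
    obtain ys zs xs where us_eq: "us = (ys, zs, xs)" by (cases us)
    define dy where "dy = \<Delta>y (Suc k)"
    define dz where "dz = \<Delta>z (Suc k)"
    define dx where "dx = x (Suc (Suc k)) - x (Suc k)"
    define d where "d = adjoint B dz"
    define r1 where "r1 = r (Suc k)"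
    define r2 where "r2 = r (Suc (Suc k))"
    have du: "u (Suc (Suc k)) - u (Suc k) = (dy, dz, dx)"
      by (simp add: u_def dy_def dz_def dx_def \<Delta>y_def \<Delta>z_def)
    have "dx = (\<tau> * \<sigma>) *\<^sub>R r2" by (simp add: dx_def r2_def x_step)
    then have "(norm dx)\<^sup>2 / (\<tau>\<^sup>2 * \<sigma>) = \<sigma> * (norm r2)\<^sup>2"
      using \<sigma> \<tau>_pos by (simp add: power_mult_distrib power2_eq_square)
    moreover have "\<nu> * (norm dx)\<^sup>2 \<le> 1 / (\<tau>\<^sup>2 * \<sigma>) * (norm dx)\<^sup>2" using \<nu>(4) by (rule mult_right_mono) simp
    ultimately have X: "\<nu> * (norm dx)\<^sup>2 \<le> \<sigma> * (norm r2)\<^sup>2" by simp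
    have "\<nu> * (norm dy)\<^sup>2 \<le> \<mu>1 * (norm dy)\<^sup>2" using \<nu>(2) by (rule mult_right_mono) simp
    then have Y: "\<nu> * (norm dy)\<^sup>2 \<le> dy \<bullet> \<Sigma>\<theta> dy + dy \<bullet> S dy + \<sigma> * (norm (adjoint A dy))\<^sup>2"
      using spec[OF \<mu>1(2), of dy] by linarith
    have "\<nu> * (norm dz)\<^sup>2 \<le> \<mu>2 * (norm dz)\<^sup>2" using \<nu>(3) by (rule mult_right_mono) simp
    then have Z: "\<nu> * (norm dz)\<^sup>2 \<le> dz \<bullet> \<Sigma>\<phi> dz + dz \<bullet> T dz + \<sigma> * (norm d)\<^sup>2"
      using spec[OF \<mu>2(2), of dz] unfolding d_def by linarith
    have "adjoint A dy = r2 - r1 - d"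
      by (simp add: dy_def dz_def \<Delta>y_def \<Delta>z_def d_def r1_def r2_def r_def linear_diff[OF adj_A] linear_diff[OF adj_B])
    then have "norm (adjoint A dy) \<le> norm r2 + norm r1 + norm d"
      by (metis add_right_mono norm_triangle_ineq4 order_trans)
    then have "(norm (adjoint A dy))\<^sup>2 \<le> (norm r2 + norm r1 + norm d)\<^sup>2" by (rule power_mono) simp
    also have "\<dots> \<le> 3 * ((norm r2)\<^sup>2 + (norm r1)\<^sup>2 + (norm d)\<^sup>2)"
      using sum_squares_bound[of "norm r2" "norm r1"] sum_squares_bound[of "norm r2" "norm d"]
        sum_squares_bound[of "norm r1" "norm d"] by (simp add: power2_sum algebra_simps)
    finally have "\<sigma> * (norm (adjoint A dy))\<^sup>2 \<le> \<sigma> * (3 * ((norm r2)\<^sup>2 + (norm r1)\<^sup>2 + (norm d)\<^sup>2))"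
      using \<sigma> by (intro mult_left_mono) auto
    then have AY: "\<sigma> * (norm (adjoint A dy))\<^sup>2 \<le> 3 * (\<sigma> * (norm r2)\<^sup>2) + 3 * (\<sigma> * (norm r1)\<^sup>2) + 3 * (\<sigma> * (norm d)\<^sup>2)"
      by (simp add: algebra_simps)
    have nn: "0 \<le> dy \<bullet> S dy" "0 \<le> dy \<bullet> \<Sigma>\<theta> dy" "0 \<le> dz \<bullet> T dz" "0 \<le> dz \<bullet> \<Sigma>\<phi> dz"
      using S T \<Sigma>\<theta> \<Sigma>\<phi> by (simp_all add: pos_semidef_nonneg)
    have nr: "0 \<le> \<sigma> * (norm r2)\<^sup>2" "0 \<le> \<sigma> * (norm r1)\<^sup>2" "0 \<le> \<sigma> * (norm d)\<^sup>2" using \<sigma> by simp_all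
    have "\<nu> * (norm (dy, dz, dx))\<^sup>2 \<le> dy \<bullet> \<Sigma>\<theta> dy + dy \<bullet> S dy + dz \<bullet> \<Sigma>\<phi> dz + dz \<bullet> T dz
        + 4 * (\<sigma> * (norm r2)\<^sup>2) + 4 * (\<sigma> * (norm r1)\<^sup>2) + 4 * (\<sigma> * (norm d)\<^sup>2)"
      using X Y Z AY nr unfolding norm_triple_square distrib_left by linarith
    from mult_left_mono[OF this, of \<epsilon>]
    have "\<epsilon> * \<nu> * (norm (dy, dz, dx))\<^sup>2 \<le> \<epsilon> * (dy \<bullet> \<Sigma>\<theta> dy) + \<epsilon> * (dy \<bullet> S dy) + \<epsilon> * (dz \<bullet> \<Sigma>\<phi> dz) + \<epsilon> * (dz \<bullet> T dz)
        + 4 * \<epsilon> * (\<sigma> * (norm r2)\<^sup>2) + 4 * \<epsilon> * (\<sigma> * (norm r1)\<^sup>2) + 4 * \<epsilon> * (\<sigma> * (norm d)\<^sup>2)"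
      using \<epsilon>(1) by (simp add: distrib_left mult_ac)
    also have "\<dots> \<le> 1/2 * (dy \<bullet> \<Sigma>\<theta> dy) + 1 * (dy \<bullet> S dy) + 1/2 * (dz \<bullet> \<Sigma>\<phi> dz) + 1 * (dz \<bullet> T dz)
        + t / 4 * (\<sigma> * (norm r2)\<^sup>2) + t / 4 * (\<sigma> * (norm r1)\<^sup>2) + \<tau> * t * (\<sigma> * (norm d)\<^sup>2)"
      using \<epsilon> nn nr by (intro add_mono mult_right_mono) linarith+
    also have "\<dots> \<le> ((u (Suc k) - us) \<bullet> M (u (Suc k) - us) + \<Delta>z k \<bullet> T (\<Delta>z k))
       - ((u (Suc (Suc k)) - us) \<bullet> M (u (Suc (Suc k)) - us) + \<Delta>z (Suc k) \<bullet> T (\<Delta>z (Suc k)))"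
      using M_descent[OF us[unfolded us_eq], of k]
      unfolding us_eq t_def[symmetric] d_def[symmetric] r1_def[symmetric] r2_def[symmetric]
        dy_def[symmetric] dz_def[symmetric] d_def[symmetric] by (simp add: algebra_simps)
    finally show "\<epsilon> * \<nu> * (norm (u (Suc (Suc k)) - u (Suc k)))\<^sup>2
      \<le> ((u (Suc k) - us) \<bullet> M (u (Suc k) - us) + \<Delta>z k \<bullet> T (\<Delta>z k))
       - ((u (Suc (Suc k)) - us) \<bullet> M (u (Suc (Suc k)) - us) + \<Delta>z (Suc k) \<bullet> T (\<Delta>z (Suc k)))"
      unfolding du .
  qed
qed

section \<open>The KKT residual\<close>

lemma R_zero_iff: "R v = 0 \<longleftrightarrow> v \<in> \<Omega>"
proof -
  obtain ys zs xs where v: "v = (ys, zs, xs)" by (cases v)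
  note \<theta>_iff = prox_fixed_point_iff[OF \<theta> y_optimality[of 0], of ys "grad g ys + A xs"]
  note \<phi>_iff = prox_fixed_point_iff[OF \<phi> z_optimality[of 0], of zs "grad h zs + B xs"]
  have "c - adjoint A ys - adjoint B zs = 0 \<longleftrightarrow> adjoint A ys + adjoint B zs = c"
    by (auto simp: algebra_simps)
  then show ?thesis unfolding v KKT_iff R_def KKT_map_def prod.case zero_prod_def prod.inject \<theta>_iff \<phi>_iff minus_add_distrib
    by simp
qed

text \<open>The new iterate solves a proximal equation whose argument differs from that of the KKT mapping by an
  expression linear in the step. The map \<open>L\<close> collects these differences, with \<open>r\<close> replaced by
  \<open>\<Delta>x / (\<tau>\<sigma>)\<close>.\<close>
lemma residual_le_step: "\<exists>C>0. \<forall>k. norm (R (u (Suc k))) \<le> C * norm (u (Suc k) - u k)"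
proof -
  define L where "L = (\<lambda>(a, b, e). (A ((1 - inverse \<tau>) *\<^sub>R e + \<sigma> *\<^sub>R adjoint B b) - S a,
      B ((1 - inverse \<tau>) *\<^sub>R e) - T b, - (inverse (\<tau> * \<sigma>) *\<^sub>R e)))"
  note lin = pos_semidef_linear[OF S] pos_semidef_linear[OF T] A B adj_B
  have "linear L" unfolding L_def
    by (rule linearI) (auto simp: lin[THEN linear_add] lin[THEN linear_diff] lin[THEN linear_scale] algebra_simps)
  then obtain C where C: "C > 0" "\<And>v. norm (L v) \<le> C * norm v" using linear_bounded_pos by blast
  have "norm (R (u (Suc k))) \<le> C * norm (u (Suc k) - u k)" for k
  proof -
    define dy where "dy = y (Suc k) - y k"
    define dz where "dz = z (Suc k) - z k"
    define dx where "dx = x (Suc k) - x k"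
    define v where "v = y (Suc k) - (grad g (y (Suc k)) + A (x (Suc k)))"
    define w where "w = z (Suc k) - (grad h (z (Suc k)) + B (x (Suc k)))"
    have xk: "x k = x (Suc k) - dx" by (simp add: dx_def)
    have rk: "r (Suc k) = inverse (\<tau> * \<sigma>) *\<^sub>R dx" using \<tau>_pos \<sigma>
      by (simp add: dx_def x_step del: inverse_mult_distrib)
    then have \<sigma>r: "\<sigma> *\<^sub>R r (Suc k) = inverse \<tau> *\<^sub>R dx" using \<sigma> by simp
    have "norm (y (Suc k) - prox \<theta> v) \<le> norm (y (Suc k) + (- (grad g (y (Suc k)))
        - A (x k + \<sigma> *\<^sub>R (r (Suc k) - adjoint B dz)) - S dy) - v)"
      unfolding dy_def dz_def by (rule prox_nonexpansive_subgradient[OF \<theta> y_optimality])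
    also have "y (Suc k) + (- (grad g (y (Suc k))) - A (x k + \<sigma> *\<^sub>R (r (Suc k) - adjoint B dz)) - S dy) - v
        = A ((1 - inverse \<tau>) *\<^sub>R dx + \<sigma> *\<^sub>R adjoint B dz) - S dy"
      unfolding v_def scaleR_diff_right \<sigma>r xk
      by (simp add: linear_add[OF A] linear_diff[OF A] linear_scale[OF A] algebra_simps)
    finally have 1: "norm (y (Suc k) - prox \<theta> v) \<le> norm (A ((1 - inverse \<tau>) *\<^sub>R dx + \<sigma> *\<^sub>R adjoint B dz) - S dy)" .
    have "norm (z (Suc k) - prox \<phi> w) \<le> norm (z (Suc k) + (- (grad h (z (Suc k)))
        - B (x k + \<sigma> *\<^sub>R r (Suc k)) - T dz) - w)"
      unfolding dz_def by (rule prox_nonexpansive_subgradient[OF \<phi> z_optimality])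
    also have "z (Suc k) + (- (grad h (z (Suc k))) - B (x k + \<sigma> *\<^sub>R r (Suc k)) - T dz) - w
        = B ((1 - inverse \<tau>) *\<^sub>R dx) - T dz"
      unfolding w_def \<sigma>r xk
      by (simp add: linear_add[OF B] linear_diff[OF B] linear_scale[OF B] algebra_simps)
    finally have 2: "norm (z (Suc k) - prox \<phi> w) \<le> norm (B ((1 - inverse \<tau>) *\<^sub>R dx) - T dz)" .
    have 3: "c - adjoint A (y (Suc k)) - adjoint B (z (Suc k)) = - (inverse (\<tau> * \<sigma>) *\<^sub>R dx)"
      unfolding rk[symmetric] by (simp add: r_def)
    have "R (u (Suc k)) = (y (Suc k) - prox \<theta> v, z (Suc k) - prox \<phi> w, - (inverse (\<tau> * \<sigma>) *\<^sub>R dx))"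
      unfolding R_def KKT_map_def u_def prod.case v_def w_def 3 ..
    then have "(norm (R (u (Suc k))))\<^sup>2 = (norm (y (Suc k) - prox \<theta> v))\<^sup>2
        + ((norm (z (Suc k) - prox \<phi> w))\<^sup>2 + (norm (- (inverse (\<tau> * \<sigma>) *\<^sub>R dx)))\<^sup>2)"
      by (simp only: norm_triple_square)
    also have "\<dots> \<le> (norm (A ((1 - inverse \<tau>) *\<^sub>R dx + \<sigma> *\<^sub>R adjoint B dz) - S dy))\<^sup>2
        + ((norm (B ((1 - inverse \<tau>) *\<^sub>R dx) - T dz))\<^sup>2 + (norm (- (inverse (\<tau> * \<sigma>) *\<^sub>R dx)))\<^sup>2)"
      by (intro add_mono power_mono 1 2) simp_all
    also have "\<dots> = (norm (L (dy, dz, dx)))\<^sup>2" unfolding L_def prod.case norm_triple_square ..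
    finally have "norm (R (u (Suc k))) \<le> norm (L (dy, dz, dx))" by (rule power2_le_imp_le) simp
    also have "\<dots> \<le> C * norm (dy, dz, dx)" by (rule C(2))
    finally show ?thesis by (simp add: u_def dy_def dz_def dx_def)
  qed
  then show ?thesis using C(1) by blast
qed

section \<open>Linear convergence\<close>

lemma M_form_minus: "(v - w) \<bullet> M (v - w) = (w - v) \<bullet> M (w - v)"
proof -
  define e where "e = w - v"
  have "v - w = - e" by (simp add: e_def)
  then show ?thesis unfolding e_def[symmetric] by (simp add: linear_neg[OF linear_M])
qed

lemma op_dist_le:
  assumes "w \<in> X"
  shows "0 \<le> op_dist M v X" and "op_dist M v X \<le> op_norm M (w - v)"
proof -
  have nn: "0 \<le> op_norm M w" for w by (simp add: op_norm_def M_nonneg)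
  show "0 \<le> op_dist M v X" unfolding op_dist_def using assms by (intro cINF_greatest nn) blast
  have "bdd_below ((\<lambda>w. op_norm M (w - v)) ` X)" by (rule bdd_belowI2[OF nn])
  then show "op_dist M v X \<le> op_norm M (w - v)" unfolding op_dist_def using assms by (rule cINF_lower)
qed

lemma op_dist_square_ge:
  assumes "X \<noteq> {}" and q: "\<And>w. w \<in> X \<Longrightarrow> q \<le> (v - w) \<bullet> M (v - w)"
  shows "q \<le> (op_dist M v X)\<^sup>2"
proof (cases "q \<le> 0")
  case False
  have "sqrt q \<le> op_dist M v X" unfolding op_dist_def
  proof (rule cINF_greatest[OF assms(1)])
    fix w assume "w \<in> X"
    then show "sqrt q \<le> op_norm M (w - v)"
      unfolding op_norm_def M_form_minus[of w] by (intro real_sqrt_le_mono q)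
  qed
  from power_mono[OF this, of 2] show ?thesis using False by simp
next
  case True
  then show ?thesis using zero_le_power2[of "op_dist M v X"] by linarith
qed

text \<open>The two inequalities \<open>up\<close> and \<open>down\<close> bound the new energy by \<open>P \<parallel>\<Delta>u\<parallel>\<^sup>2\<close> and by the old energy minus
  \<open>\<kappa> \<parallel>\<Delta>u\<parallel>\<^sup>2\<close>. For \<open>down\<close>, the descent constant must be the same for all KKT points, since the infimum over them
  is taken on the right-hand side.\<close>
lemma linear_rate:
  assumes ne: "\<Omega> \<noteq> {}" and pp: "piecewise_polyhedral (\<lambda>v. {R v})"
  shows "\<exists>\<rho>\<in>{0<..<1}. \<forall>k. (op_dist M (u (Suc (Suc k))) \<Omega>)\<^sup>2 + \<Delta>z (Suc k) \<bullet> T (\<Delta>z (Suc k))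
     \<le> \<rho> * ((op_dist M (u (Suc k)) \<Omega>)\<^sup>2 + \<Delta>z k \<bullet> T (\<Delta>z k))"
proof -
  obtain us where us: "us \<in> \<Omega>" using ne by blast
  obtain \<kappa> where \<kappa>: "\<kappa> > 0" and desc: "\<forall>us\<in>\<Omega>. \<forall>k. \<kappa> * (norm (u (Suc (Suc k)) - u (Suc k)))\<^sup>2
     \<le> ((u (Suc k) - us) \<bullet> M (u (Suc k) - us) + \<Delta>z k \<bullet> T (\<Delta>z k))
       - ((u (Suc (Suc k)) - us) \<bullet> M (u (Suc (Suc k)) - us) + \<Delta>z (Suc k) \<bullet> T (\<Delta>z (Suc k)))"
    using sufficient_descent by (elim exE conjE)
  have descent: "\<kappa> * (norm (u (Suc (Suc k)) - u (Suc k)))\<^sup>2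
     \<le> ((u (Suc k) - us) \<bullet> M (u (Suc k) - us) + \<Delta>z k \<bullet> T (\<Delta>z k))
       - ((u (Suc (Suc k)) - us) \<bullet> M (u (Suc (Suc k)) - us) + \<Delta>z (Suc k) \<bullet> T (\<Delta>z (Suc k)))"
    if "us \<in> \<Omega>" for us k
    using bspec[OF desc that] by (rule spec)
  obtain C where C: "C > 0" "\<forall>k. norm (R (u (Suc k))) \<le> C * norm (u (Suc k) - u k)"
    using residual_le_step by (elim exE conjE)
  have "\<exists>\<mu>>0. \<forall>v. \<mu> * (norm v)\<^sup>2 \<le> v \<bullet> M v"
    by (rule quadratic_form_lower_bound[OF linear_M]) (rule M_positive)
  then obtain \<mu> where \<mu>: "\<mu> > 0" "\<forall>v. \<mu> * (norm v)\<^sup>2 \<le> v \<bullet> M v" by (elim exE conjE)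
  obtain CM where CM: "CM > 0" "\<forall>v. v \<bullet> M v \<le> CM * (norm v)\<^sup>2"
    using quadratic_form_upper_bound[OF linear_M] by (elim exE conjE)
  obtain CT where CT: "CT > 0" "\<forall>v. v \<bullet> T v \<le> CT * (norm v)\<^sup>2"
    using quadratic_form_upper_bound[OF pos_semidef_linear[OF T]] by (elim exE conjE)
  have T0: "0 \<le> \<Delta>z k \<bullet> T (\<Delta>z k)" for k by (rule pos_semidef_nonneg[OF T])

  define W where "W k = (u (Suc k) - us) \<bullet> M (u (Suc k) - us) + \<Delta>z k \<bullet> T (\<Delta>z k)" for k
  have "W (Suc k) \<le> W k" for k
  proof -
    have "0 \<le> \<kappa> * (norm (u (Suc (Suc k)) - u (Suc k)))\<^sup>2" using \<kappa> by simp
    then show ?thesis using descent[OF us, of k] unfolding W_def by linarith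
  qed
  then have Wdec: "W k \<le> W 0" for k
    using lift_Suc_antimono_le[of W 0 k] by simp
  define b where "b = sqrt (W 0 / \<mu>)"
  have ub: "norm (u (Suc k) - us) \<le> b" for k
  proof -
    have "\<mu> * (norm (u (Suc k) - us))\<^sup>2 \<le> W k"
      using \<mu>(2)[rule_format, of "u (Suc k) - us"] T0[of k] unfolding W_def by linarith
    then have "(norm (u (Suc k) - us))\<^sup>2 \<le> W 0 / \<mu>" using Wdec[of k] \<mu>(1) by (simp add: field_simps)
    then show ?thesis unfolding b_def by (rule real_le_rsqrt)
  qed
  \<comment> \<open>The residuals must be bounded too, because the error bound holds on bounded parts of the graph of \<open>R\<close>.\<close>
  define K where "K = range (\<lambda>k. (u (Suc (Suc k)), R (u (Suc (Suc k)))))"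
  have "K \<subseteq> cball us b \<times> cball 0 (C * (2 * b))"
  proof -
    have "norm (R (u (Suc (Suc k)))) \<le> C * (2 * b)" for k
    proof -
      have "norm (u (Suc (Suc k)) - u (Suc k)) \<le> norm (u (Suc (Suc k)) - us) + norm (u (Suc k) - us)"
        using norm_triangle_ineq4[of "u (Suc (Suc k)) - us" "u (Suc k) - us"] by simp
      also have "\<dots> \<le> 2 * b" using ub[of k] ub[of "Suc k"] by simp
      finally have "C * norm (u (Suc (Suc k)) - u (Suc k)) \<le> C * (2 * b)" using C(1) by simp
      then show ?thesis using C(2)[rule_format, of "Suc k"] by simp
    qed
    then show ?thesis using ub by (auto simp: K_def dist_norm norm_minus_commute)
  qed
  then have "bounded K" by (rule bounded_subset[rotated]) (intro bounded_Times bounded_cball)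
  have "\<exists>v. 0 \<in> {R v}" using us R_zero_iff[of us] by (intro exI[of _ us]) simp
  from piecewise_polyhedral_error_bound[OF pp this \<open>bounded K\<close>]
  obtain \<eta> where \<eta>: "\<eta> \<ge> 0" "\<forall>v w. w \<in> {R v} \<and> (v, w) \<in> K \<longrightarrow>
      (\<exists>v'. 0 \<in> {R v'} \<and> norm (v' - v) \<le> \<eta> * norm w)"
    by (elim exE conjE)
  have near: "\<exists>v'\<in>\<Omega>. norm (v' - u (Suc (Suc k))) \<le> \<eta> * norm (R (u (Suc (Suc k))))" for k
  proof -
    have "R (u (Suc (Suc k))) \<in> {R (u (Suc (Suc k)))} \<and> (u (Suc (Suc k)), R (u (Suc (Suc k)))) \<in> K"
      by (simp add: K_def)
    from \<eta>(2)[THEN spec, THEN spec, THEN mp, OF this] obtain v'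
      where "0 \<in> {R v'}" "norm (v' - u (Suc (Suc k))) \<le> \<eta> * norm (R (u (Suc (Suc k))))"
      by (elim exE conjE)
    then show ?thesis using R_zero_iff[of v'] by (intro bexI[of _ v']) simp_all
  qed

  define a where "a k = (op_dist M (u (Suc k)) \<Omega>)\<^sup>2 + \<Delta>z k \<bullet> T (\<Delta>z k)" for k
  define \<delta> where "\<delta> k = (norm (u (Suc (Suc k)) - u (Suc k)))\<^sup>2" for k
  define P where "P = CM * (\<eta> * C)\<^sup>2 + CT"
  have P: "P > 0" using CM(1) CT(1) unfolding P_def by (intro add_nonneg_pos) simp_all
  have up: "a (Suc k) \<le> P * \<delta> k" for k
  proof -
    obtain v' where v': "v' \<in> \<Omega>" "norm (v' - u (Suc (Suc k))) \<le> \<eta> * norm (R (u (Suc (Suc k))))"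
      using near[of k] by (elim bexE)
    have "\<eta> * norm (R (u (Suc (Suc k)))) \<le> \<eta> * (C * norm (u (Suc (Suc k)) - u (Suc k)))"
      using C(2) \<eta>(1) by (intro mult_left_mono) simp_all
    with v'(2) have "norm (v' - u (Suc (Suc k))) \<le> \<eta> * C * norm (u (Suc (Suc k)) - u (Suc k))"
      by (simp add: mult.assoc)
    then have "(norm (v' - u (Suc (Suc k))))\<^sup>2 \<le> (\<eta> * C * norm (u (Suc (Suc k)) - u (Suc k)))\<^sup>2"
      by (rule power_mono) simp
    then have n: "(norm (v' - u (Suc (Suc k))))\<^sup>2 \<le> (\<eta> * C)\<^sup>2 * \<delta> k"
      by (simp add: \<delta>_def power_mult_distrib)
    have "(op_dist M (u (Suc (Suc k))) \<Omega>)\<^sup>2 \<le> (op_norm M (v' - u (Suc (Suc k))))\<^sup>2"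
      using op_dist_le[OF v'(1)] by (intro power_mono)
    also have "\<dots> \<le> CM * (norm (v' - u (Suc (Suc k))))\<^sup>2" unfolding op_norm_M using CM(2) by blast
    also have "\<dots> \<le> CM * ((\<eta> * C)\<^sup>2 * \<delta> k)" using n CM(1) by (intro mult_left_mono) simp_all
    finally have 1: "(op_dist M (u (Suc (Suc k))) \<Omega>)\<^sup>2 \<le> CM * ((\<eta> * C)\<^sup>2 * \<delta> k)" .
    have "(norm (\<Delta>z (Suc k)))\<^sup>2 \<le> \<delta> k"
      by (simp add: \<delta>_def u_def \<Delta>z_def norm_triple_square)
    then have "CT * (norm (\<Delta>z (Suc k)))\<^sup>2 \<le> CT * \<delta> k" using CT(1) by (intro mult_left_mono) simp_all
    then have 2: "\<Delta>z (Suc k) \<bullet> T (\<Delta>z (Suc k)) \<le> CT * \<delta> k" using CT(2) by (meson order_trans)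
    show ?thesis using 1 2 by (simp add: a_def P_def algebra_simps)
  qed
  have down: "a (Suc k) + \<kappa> * \<delta> k \<le> a k" for k
  proof -
    have "a (Suc k) + \<kappa> * \<delta> k - \<Delta>z k \<bullet> T (\<Delta>z k) \<le> (op_dist M (u (Suc k)) \<Omega>)\<^sup>2"
    proof (rule op_dist_square_ge[OF ne])
      fix w assume w: "w \<in> \<Omega>"
      have "(op_dist M (u (Suc (Suc k))) \<Omega>)\<^sup>2 \<le> (op_norm M (w - u (Suc (Suc k))))\<^sup>2"
        using op_dist_le[OF w] by (intro power_mono)
      also have "\<dots> = (u (Suc (Suc k)) - w) \<bullet> M (u (Suc (Suc k)) - w)"
        unfolding op_norm_M by (rule M_form_minus)
      finally show "a (Suc k) + \<kappa> * \<delta> k - \<Delta>z k \<bullet> T (\<Delta>z k) \<le> (u (Suc k) - w) \<bullet> M (u (Suc k) - w)"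
        using descent[OF w, of k] unfolding a_def \<delta>_def by linarith
    qed
    then show ?thesis by (simp add: a_def)
  qed
  have "a (Suc k) \<le> P / (P + \<kappa>) * a k" for k
  proof -
    have "\<kappa> * a (Suc k) \<le> P * (\<kappa> * \<delta> k)" using mult_left_mono[OF up[of k], of \<kappa>] \<kappa> by (simp add: mult_ac)
    moreover have "P * (a (Suc k) + \<kappa> * \<delta> k) \<le> P * a k" using down P by (intro mult_left_mono) simp_all
    ultimately have "(P + \<kappa>) * a (Suc k) \<le> P * a k" by (simp add: algebra_simps)
    then show ?thesis using P \<kappa> by (simp add: field_simps)
  qed
  moreover have "P / (P + \<kappa>) \<in> {0<..<1}" using P \<kappa> by simp
  ultimately show ?thesis unfolding a_def by (intro bexI[of _ "P / (P + \<kappa>)"] allI)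
qed

end

theorem corollary3p1:
  fixes \<theta> :: "'y::euclidean_space \<Rightarrow> ereal" and g :: "'y \<Rightarrow> real"
    and \<phi> :: "'z::euclidean_space \<Rightarrow> ereal" and h :: "'z \<Rightarrow> real"
    and A :: "'x::euclidean_space \<Rightarrow> 'y" and B :: "'x \<Rightarrow> 'z" and c :: 'x
    and \<sigma> \<tau> :: real
    and S \<Sigma>\<theta> :: "'y \<Rightarrow> 'y" and T \<Sigma>\<phi> :: "'z \<Rightarrow> 'z"
    and y :: "nat \<Rightarrow> 'y" and z :: "nat \<Rightarrow> 'z" and x :: "nat \<Rightarrow> 'x"
  defines "\<Omega> \<equiv> KKT_set \<theta> g \<phi> h A B c"
    and "M \<equiv> M_op A B \<sigma> \<tau> S T \<Sigma>\<theta> \<Sigma>\<phi>"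
    and "u \<equiv> (\<lambda>k. (y k, z k, x k))"
  assumes "proper_closed_convex \<theta>" and "proper_closed_convex \<phi>"
    and "cont_diff_convex g" and "cont_diff_convex h"
    and "linear A" and "linear B"
    and "\<sigma> > 0"
    and "\<tau> \<in> {0<..<(1 + sqrt 5) / 2}"
    and "pos_semidef S" and "pos_semidef T"
    and "monotone_modulus (plus_smooth \<theta> g) \<Sigma>\<theta>"
    and "monotone_modulus (plus_smooth \<phi> h) \<Sigma>\<phi>"
    and "\<Omega> \<noteq> {}"
    and "pos_def (\<lambda>v. \<Sigma>\<theta> v + S v + \<sigma> *\<^sub>R A (adjoint A v))"
    and "pos_def (\<lambda>w. \<Sigma>\<phi> w + T w + \<sigma> *\<^sub>R B (adjoint B w))"
    and "piecewise_polyhedral (\<lambda>v. {KKT_map \<theta> g \<phi> h A B c v})"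
    and "sPADMM_sequence \<theta> g \<phi> h A B c \<sigma> \<tau> S T y z x"
  shows "\<exists>\<rho>\<in>{0<..<1}. \<forall>k\<ge>1.
     (op_dist M (u (k + 1)) \<Omega>)\<^sup>2 + (op_norm T (z (k + 1) - z k))\<^sup>2
       \<le> \<rho> * ((op_dist M (u k) \<Omega>)\<^sup>2 + (op_norm T (z k - z (k - 1)))\<^sup>2)"
proof -
  interpret admm: semi_proximal_ADMM \<theta> g \<phi> h A B c \<sigma> \<tau> S \<Sigma>\<theta> T \<Sigma>\<phi> y z x
    by (rule semi_proximal_ADMM.intro) (fact assms)+
  have eqs: "\<Omega> = admm.\<Omega>" "M = admm.M" "u = admm.u"
    by (simp_all add: \<Omega>_def M_def u_def admm.\<Omega>_def admm.M_def fun_eq_iff admm.u_def)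
  have "\<Omega> \<noteq> {}" by (fact assms)
  then have "admm.\<Omega> \<noteq> {}" unfolding eqs .
  moreover have "piecewise_polyhedral (\<lambda>v. {admm.R v})" unfolding admm.R_def by (fact assms)
  ultimately obtain \<rho> where \<rho>: "\<rho> \<in> {0<..<1}" "\<forall>k. (op_dist M (u (Suc (Suc k))) \<Omega>)\<^sup>2
      + admm.\<Delta>z (Suc k) \<bullet> T (admm.\<Delta>z (Suc k))
      \<le> \<rho> * ((op_dist M (u (Suc k)) \<Omega>)\<^sup>2 + admm.\<Delta>z k \<bullet> T (admm.\<Delta>z k))"
    unfolding eqs using admm.linear_rate by blast
  show ?thesis
  proof (intro bexI[OF _ \<rho>(1)] allI impI)
    fix k :: nat assume "k \<ge> 1"
    then obtain j where "k = Suc j" by (cases k) auto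
    then show "(op_dist M (u (k + 1)) \<Omega>)\<^sup>2 + (op_norm T (z (k + 1) - z k))\<^sup>2
       \<le> \<rho> * ((op_dist M (u k) \<Omega>)\<^sup>2 + (op_norm T (z k - z (k - 1)))\<^sup>2)"
      using spec[OF \<rho>(2), of j] by (simp add: op_norm_square[OF admm.T] admm.\<Delta>z_def)
  qed
qed

end
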